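(* Let $\Omega\subseteq\mathbb{R}^n$ be an open set, let $1\le p<\infty$, and let $w$ be an admissible weight on $\Omega$ (in the sense defined in the context). Let $$\Omega_w:=\{(x,y)\in\mathbb{R}^n\times\mathbb{R} : x\in\Omega,\ 0<y<w(x)\}$$ be the subgraph of $w$. If the (unweighted) embedding $W^{1,p}(\Omega_w)\to L^p(\Omega_w)$ is compact, then the embedding $W^{1,p}(\Omega,w)\to L^p(\Omega,w)$ is compact.
   Context: A weight on an open set $\Omega\subseteq\mathbb{R}^n$ is a measurable function $w$ on $\Omega$ that is a.e. positive and finite. Standing assumption on $w$: if $p>1$, then $w^{-1/(p-1)}\in L^1_{\mathrm{loc}}(\Omega)$; if $p=1$, then $\operatorname{ess\,sup}_{x\in B}\frac1{w(x)}<+\infty$ for every ball $B\subset\Omega$. (Under this assumption $L^p(\Omega,w)\subseteq L^1_{\mathrm{loc}}(\Omega)$.) Here a weight $w$ (satisfying the standing assumption, nonnegative, with the value $+\infty$ allowed) is called admissible if: $w$ is lower semicontinuous on $\Omega$; $w$ vanishes only on a closed subset $\Omega_0$ of $\Omega$; the set $\Omega_\infty:=\{x\in\Omega : w(x)=+\infty\}$ is closed; both $\Omega_0$ and $\Omega_\infty$ have Lebesgue measure zero; and $w$ is bounded from above and from below by positive constants on every compact set $K\subset\Omega\setminus(\Omega_0\cup\Omega_\infty)$. $L^p(\Omega,w)$ is the space of measurable $u$ with $\|u\|_{L^p(\Omega,w)}=\left(\int_\Omega |u(x)|^p w(x)\,dx\right)^{1/p}<+\infty$. $W^{1,p}(\Omega,w)$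 is the space of $u\in L^p(\Omega,w)$ whose first-order distributional derivatives belong to $L^p(\Omega,w)$, with norm $\left(\int_\Omega |u|^p w\,dx+\int_\Omega|\nabla u|^p w\,dx\right)^{1/p}$. $L^p(\Omega_w)$ and $W^{1,p}(\Omega_w)$ are the usual unweighted spaces on the open set $\Omega_w\subseteq\mathbb{R}^{n+1}$. *)

theory Defs
  imports "HOL-Analysis.Analysis" "HOL-Probability.Essential_Supremum"
begin

subsection \<open>Weights\<close>

definition locally_integrable_on ::
    "('a::euclidean_space \<Rightarrow> real) \<Rightarrow> 'a set \<Rightarrow> bool"  (infix "locally'_integrable'_on" 50) where
  "f locally_integrable_on \<Omega> \<longleftrightarrow> (\<forall>K. compact K \<and> K \<subseteq> \<Omega> \<longrightarrow> integrable (lebesgue_on K) f)"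

definition weight_on :: "'a::euclidean_space set \<Rightarrow> ('a \<Rightarrow> ennreal) \<Rightarrow> bool" where
  "weight_on \<Omega> w \<longleftrightarrow>
     w \<in> borel_measurable (lebesgue_on \<Omega>) \<and> (AE x in lebesgue_on \<Omega>. 0 < w x \<and> w x < \<infinity>)"

text \<open>
  The real power \<open>enn2real (w x) powr (- 1 / (p - 1))\<close> has the junk value \<open>0\<close> where
  \<open>w x = 0\<close>.  This does not matter: a weight is positive and finite almost everywhere, and
  both properties below only depend on \<open>w\<close> up to null sets.
\<close>

definition standing_assumption ::
    "real \<Rightarrow> 'a::euclidean_space set \<Rightarrow> ('a \<Rightarrow> ennreal) \<Rightarrow> bool" where
  "standing_assumption p \<Omega> w \<longleftrightarrow>
     (p > 1 \<longrightarrow> (\<lambda>x. enn2real (w x) powr (- 1 / (p - 1))) locally_integrable_on \<Omega>) \<and>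
     (p = 1 \<longrightarrow> (\<forall>c r. 0 < r \<and> ball c r \<subseteq> \<Omega> \<longrightarrow>
                    esssup (lebesgue_on (ball c r)) (\<lambda>x. inverse (w x)) < \<infinity>))"

definition lower_semicontinuous_on ::
    "'a::topological_space set \<Rightarrow> ('a \<Rightarrow> ennreal) \<Rightarrow> bool" where
  "lower_semicontinuous_on \<Omega> w \<longleftrightarrow>
     (\<forall>x\<in>\<Omega>. \<forall>t<w x. eventually (\<lambda>y. t < w y) (at x within \<Omega>))"

definition zero_set :: "'a set \<Rightarrow> ('a \<Rightarrow> ennreal) \<Rightarrow> 'a set" where
  "zero_set \<Omega> w = {x \<in> \<Omega>. w x = 0}"

definition infinity_set :: "'a set \<Rightarrow> ('a \<Rightarrow> ennreal) \<Rightarrow> 'a set" where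
  "infinity_set \<Omega> w = {x \<in> \<Omega>. w x = \<infinity>}"

text \<open>Closedness of the two exceptional sets is understood relative to \<open>\<Omega>\<close>.\<close>

definition admissible_weight ::
    "real \<Rightarrow> 'a::euclidean_space set \<Rightarrow> ('a \<Rightarrow> ennreal) \<Rightarrow> bool" where
  "admissible_weight p \<Omega> w \<longleftrightarrow>
     weight_on \<Omega> w \<and>
     standing_assumption p \<Omega> w \<and>
     lower_semicontinuous_on \<Omega> w \<and>
     closedin (top_of_set \<Omega>) (zero_set \<Omega> w) \<and>
     closedin (top_of_set \<Omega>) (infinity_set \<Omega> w) \<and>
     negligible (zero_set \<Omega> w) \<and>
     negligible (infinity_set \<Omega> w) \<and>
     (\<forall>K. compact K \<and> K \<subseteq> \<Omega> - (zero_set \<Omega> w \<union> infinity_set \<Omega> w) \<longrightarrow>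
        (\<exists>a b::real. 0 < a \<and> 0 < b \<and> (\<forall>x\<in>K. ennreal a \<le> w x \<and> w x \<le> ennreal b)))"

definition subgraph :: "'a set \<Rightarrow> ('a \<Rightarrow> ennreal) \<Rightarrow> ('a \<times> real) set" where
  "subgraph \<Omega> w = {(x, y). x \<in> \<Omega> \<and> 0 < y \<and> ennreal y < w x}"


subsection \<open>Weighted Lebesgue spaces\<close>

text \<open>
  Elements of the spaces are real functions on the whole type of which only the values on
  \<open>\<Omega>\<close> matter; functions that agree almost everywhere on \<open>\<Omega>\<close> are not identified, so that
  the norms are seminorms on these sets of representatives.
\<close>

definition Lp_space ::
    "real \<Rightarrow> 'a::euclidean_space set \<Rightarrow> ('a \<Rightarrow> ennreal) \<Rightarrow> ('a \<Rightarrow> real) set" where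
  "Lp_space p \<Omega> w =
     {u \<in> borel_measurable (lebesgue_on \<Omega>).
        (\<integral>\<^sup>+x. ennreal (\<bar>u x\<bar> powr p) * w x \<partial>lebesgue_on \<Omega>) < \<infinity>}"

definition Lp_norm ::
    "real \<Rightarrow> 'a::euclidean_space set \<Rightarrow> ('a \<Rightarrow> ennreal) \<Rightarrow> ('a \<Rightarrow> real) \<Rightarrow> real" where
  "Lp_norm p \<Omega> w u =
     enn2real (\<integral>\<^sup>+x. ennreal (\<bar>u x\<bar> powr p) * w x \<partial>lebesgue_on \<Omega>) powr (1 / p)"


subsection \<open>Distributional derivatives and weighted Sobolev spaces\<close>

primrec Ck_function :: "nat \<Rightarrow> ('a::euclidean_space \<Rightarrow> real) \<Rightarrow> bool" where
  "Ck_function 0 f \<longleftrightarrow> continuous_on UNIV f"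
| "Ck_function (Suc k) f \<longleftrightarrow>
     (\<forall>x. f differentiable (at x)) \<and>
     (\<forall>b\<in>Basis. Ck_function k (\<lambda>x. frechet_derivative f (at x) b))"

definition test_function :: "'a::euclidean_space set \<Rightarrow> ('a \<Rightarrow> real) \<Rightarrow> bool" where
  "test_function \<Omega> \<phi> \<longleftrightarrow>
     (\<forall>k. Ck_function k \<phi>) \<and>
     compact (closure {x. \<phi> x \<noteq> 0}) \<and> closure {x. \<phi> x \<noteq> 0} \<subseteq> \<Omega>"

text \<open>\<open>v\<close> is the distributional derivative of \<open>u\<close> on \<open>\<Omega>\<close> in the coordinate direction \<open>b\<close>.\<close>

definition has_weak_derivative ::
    "'a::euclidean_space set \<Rightarrow> 'a \<Rightarrow> ('a \<Rightarrow> real) \<Rightarrow> ('a \<Rightarrow> real) \<Rightarrow> bool" where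
  "has_weak_derivative \<Omega> b u v \<longleftrightarrow>
     u locally_integrable_on \<Omega> \<and> v locally_integrable_on \<Omega> \<and>
     (\<forall>\<phi>. test_function \<Omega> \<phi> \<longrightarrow>
        (\<integral>x. u x * frechet_derivative \<phi> (at x) b \<partial>lebesgue_on \<Omega>) =
          - (\<integral>x. v x * \<phi> x \<partial>lebesgue_on \<Omega>))"

text \<open>Some representative; any two agree almost everywhere on the open set \<open>\<Omega>\<close>.\<close>

definition weak_gradient ::
    "'a::euclidean_space set \<Rightarrow> ('a \<Rightarrow> real) \<Rightarrow> 'a \<Rightarrow> 'a" where
  "weak_gradient \<Omega> u =
     (SOME g. \<forall>b\<in>Basis. has_weak_derivative \<Omega> b u (\<lambda>x. g x \<bullet> b))"

definition W1p_space ::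
    "real \<Rightarrow> 'a::euclidean_space set \<Rightarrow> ('a \<Rightarrow> ennreal) \<Rightarrow> ('a \<Rightarrow> real) set" where
  "W1p_space p \<Omega> w =
     {u \<in> Lp_space p \<Omega> w. \<forall>b\<in>Basis. \<exists>v\<in>Lp_space p \<Omega> w. has_weak_derivative \<Omega> b u v}"

definition W1p_norm ::
    "real \<Rightarrow> 'a::euclidean_space set \<Rightarrow> ('a \<Rightarrow> ennreal) \<Rightarrow> ('a \<Rightarrow> real) \<Rightarrow> real" where
  "W1p_norm p \<Omega> w u =
     enn2real ((\<integral>\<^sup>+x. ennreal (\<bar>u x\<bar> powr p) * w x \<partial>lebesgue_on \<Omega>) +
               (\<integral>\<^sup>+x. ennreal (norm (weak_gradient \<Omega> u x) powr p) * w x \<partial>lebesgue_on \<Omega>))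
       powr (1 / p)"

text \<open>The unweighted spaces are those with weight \<open>1\<close>.\<close>

abbreviation unweighted :: "'a \<Rightarrow> ennreal" where
  "unweighted \<equiv> (\<lambda>_. 1)"


subsection \<open>Compact embeddings\<close>

text \<open>
  A (semi)normed function space \<open>(X, NX)\<close> is compactly embedded in \<open>(Y, NY)\<close> if it is contained
  in \<open>Y\<close>, the inclusion is bounded, and every sequence bounded in \<open>X\<close> has a subsequence
  converging in \<open>Y\<close>.
\<close>

definition compact_embedding ::
    "('a \<Rightarrow> real) set \<Rightarrow> (('a \<Rightarrow> real) \<Rightarrow> real) \<Rightarrow>
     ('a \<Rightarrow> real) set \<Rightarrow> (('a \<Rightarrow> real) \<Rightarrow> real) \<Rightarrow> bool" where
  "compact_embedding X NX Y NY \<longleftrightarrow>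
     X \<subseteq> Y \<and>
     (\<exists>C. \<forall>u\<in>X. NY u \<le> C * NX u) \<and>
     (\<forall>s :: nat \<Rightarrow> 'a \<Rightarrow> real.
        (\<forall>k. s k \<in> X) \<and> (\<exists>M. \<forall>k. NX (s k) \<le> M) \<longrightarrow>
        (\<exists>v\<in>Y. \<exists>r :: nat \<Rightarrow> nat. strict_mono r \<and>
           (\<lambda>k. NY (\<lambda>x. s (r k) x - v x)) \<longlonglongrightarrow> 0))"

definition W1p_compactly_embedded ::
    "real \<Rightarrow> 'a::euclidean_space set \<Rightarrow> ('a \<Rightarrow> ennreal) \<Rightarrow> bool" where
  "W1p_compactly_embedded p \<Omega> w \<longleftrightarrow>
     compact_embedding (W1p_space p \<Omega> w) (W1p_norm p \<Omega> w) (Lp_space p \<Omega> w) (Lp_norm p \<Omega> w)"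

end

theory Submission
  imports Defs
begin

text \<open>
  The lifting \<open>T u (x, y) = u x\<close> embeds the weighted spaces on \<open>\<Omega>\<close> isometrically into the
  unweighted spaces on the subgraph \<open>\<Omega>\<^sub>w\<close>: integrating a function of \<open>x\<close> alone over the slice
  \<open>0 < y < w x\<close> multiplies it by \<open>w x\<close>, so that the integral of \<open>\<bar>T u\<bar>\<^sup>p\<close> over \<open>\<Omega>\<^sub>w\<close> is that of
  \<open>\<bar>u\<bar>\<^sup>p w\<close> over \<open>\<Omega>\<close> (\<open>nn_integral_subgraph\<close>).  The weak gradient of \<open>T u\<close> is \<open>(\<nabla>u, 0)\<close>, so the same
  identity holds for the gradient terms (\<open>W1p_norm_subgraph\<close>).  A bounded sequence in the weighted
  Sobolev space is therefore lifted to a bounded sequence on \<open>\<Omega>\<^sub>w\<close>, and a subsequence of the lifted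
  functions converges in \<open>L\<^sup>p\<close>.  Its limit is again a lifted function, and the function that it
  comes from is the limit in the weighted space (\<open>Lp_limit_on_subgraph\<close>).

  Two of these steps need work.  First, the gradient of \<open>T u\<close>: horizontal slices of a test function
  on \<open>\<Omega>\<^sub>w\<close> are test functions on \<open>\<Omega>\<close>, so Fubini's theorem gives the derivatives in the directions
  of \<open>x\<close> (\<open>has_weak_derivative_fst\<close>), and the fundamental theorem of calculus on vertical lines shows
  that the derivative in \<open>y\<close> vanishes (\<open>has_weak_derivative_fst_vertical\<close>).  Secondly, the Sobolev
  norm uses an arbitrarily chosen representative of the weak gradient, so weak derivatives have to
  be unique almost everywhere on \<open>\<Omega>\<^sub>w\<close>.  The subgraph is open because \<open>w\<close> is lower semicontinuous
  (\<open>open_subgraph\<close>), so uniqueness follows from the fundamental lemma of the calculus of variations.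
  Its proof tests against explicit smooth bumps that approximate the indicators of boxes.
\<close>

section \<open>Smooth bump functions on boxes\<close>

text \<open>
  The derivatives of \<open>flat 0\<close>, which is the classical smooth function \<open>exp (- 1 / t)\<close> extended by
  zero, are combinations of these functions; the parameter \<open>m\<close> is there to make the family
  closed under differentiation.
\<close>
definition flat :: "nat \<Rightarrow> real \<Rightarrow> real" where
  "flat m t = (if 0 < t then exp (- (1 / t)) / t ^ m else 0)"

text \<open>
  Substituting \<open>s = 1 / t\<close> turns this into the fact that \<open>exp\<close> grows faster than any power.
\<close>
lemma flat_tendsto_0: "(flat m \<longlongrightarrow> 0) (at 0)"
proof -
  have "((\<lambda>s. s ^ m / exp s) \<longlongrightarrow> (0::real)) at_top"
    by (rule tendsto_power_div_exp_0)
  then have "((\<lambda>t. inverse t ^ m / exp (inverse t)) \<longlongrightarrow> (0::real)) (at_right 0)"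
    by (rule filterlim_compose[OF _ filterlim_inverse_at_top_right])
  moreover have "\<forall>\<^sub>F t in at_right 0. inverse t ^ m / exp (inverse t) = flat m t"
    by (auto simp: eventually_at_filter flat_def exp_minus field_simps)
  ultimately have "(flat m \<longlongrightarrow> 0) (at_right 0)"
    by (rule Lim_transform_eventually)
  moreover have "(flat m \<longlongrightarrow> 0) (at_left 0)"
    by (rule Lim_transform_eventually[OF tendsto_const])
       (auto simp: eventually_at_filter flat_def)
  ultimately show ?thesis
    by (simp add: filterlim_at_split)
qed

text \<open>
  Away from zero this is a computation.  At zero the difference quotient of \<open>flat m\<close> is
  \<open>flat (m + 1)\<close>, which tends to zero, so the same formula holds.
\<close>
lemma flat_has_real_derivative:
  "(flat m has_real_derivative flat (m + 2) t - real m * flat (m + 1) t) (at t)"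
proof (cases t "0::real" rule: linorder_cases)
  case less
  have "((\<lambda>_. 0) has_real_derivative 0) (at t)" by simp
  moreover have "\<forall>\<^sub>F s in nhds t. 0 = flat m s"
    using eventually_nhds_in_open[of "{..<0}" t] less
    by (auto elim!: eventually_mono simp: flat_def)
  ultimately have "(flat m has_real_derivative 0) (at t)"
    using DERIV_cong_ev[of t t "\<lambda>_. 0" "flat m" 0 0] by simp
  then show ?thesis using less by (simp add: flat_def)
next
  case equal
  have "((\<lambda>h. (flat m (0 + h) - flat m 0) / h) \<longlongrightarrow> 0) (at 0)"
    by (rule Lim_transform_eventually[OF flat_tendsto_0[of "Suc m"]])
       (auto simp: eventually_at_filter flat_def)
  then show ?thesis
    using equal by (simp add: DERIV_def flat_def)
next
  case greater
  have "((\<lambda>t. exp (- (1 / t)) / t ^ m) has_real_derivative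
          exp (- (1 / t)) / t ^ (m + 2) - real m * (exp (- (1 / t)) / t ^ (m + 1))) (at t)"
  proof -
    have "((\<lambda>t. exp (- inverse t) * inverse t ^ m) has_real_derivative
        exp (- inverse t) * (inverse t * inverse t) * inverse t ^ m
        - exp (- inverse t) * (real m * inverse t ^ (m - Suc 0) * (inverse t * inverse t))) (at t)"
      using greater by (auto intro!: derivative_eq_intros)
    also have "real m * inverse t ^ (m - Suc 0) * (inverse t * inverse t) = real m * inverse t ^ (m + 1)"
      by (cases m) auto
    finally show ?thesis
      by (simp add: divide_inverse power_inverse[symmetric] mult_ac)
  qed
  moreover have "\<forall>\<^sub>F s in nhds t. exp (- (1 / s)) / s ^ m = flat m s"
    using eventually_nhds_in_open[of "{0<..}" t] greater
    by (auto elim!: eventually_mono simp: flat_def)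
  ultimately have "(flat m has_real_derivative
          exp (- (1 / t)) / t ^ (m + 2) - real m * (exp (- (1 / t)) / t ^ (m + 1))) (at t)"
    using DERIV_cong_ev[OF refl _ refl, of "\<lambda>t. exp (- (1 / t)) / t ^ m" "flat m" t] by simp
  then show ?thesis using greater by (simp add: flat_def)
qed

text \<open>
  Smoothness is proved once for a whole algebra of functions that contains all coordinate-wise
  cut-offs and is closed under directional derivatives; this avoids any formula for the higher
  derivatives of an individual bump function.
\<close>
inductive flat_algebra :: "('a::euclidean_space \<Rightarrow> real) \<Rightarrow> bool" where
  const: "flat_algebra (\<lambda>_. c)"
| flat: "flat_algebra (\<lambda>x. flat m (c * (x \<bullet> i) + d))"
| add: "flat_algebra f \<Longrightarrow> flat_algebra g \<Longrightarrow> flat_algebra (\<lambda>x. f x + g x)"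
| mult: "flat_algebra f \<Longrightarrow> flat_algebra g \<Longrightarrow> flat_algebra (\<lambda>x. f x * g x)"

lemma flat_algebra_derivative:
  assumes "flat_algebra f"
  shows "(\<forall>x. f differentiable (at x)) \<and> (\<forall>b. flat_algebra (\<lambda>x. frechet_derivative f (at x) b))"
  using assms
proof induction
  case (const c)
  show ?case by (simp add: flat_algebra.const)
next
  case (flat m c i d)
  have D: "((\<lambda>x. flat m (c * (x \<bullet> i) + d)) has_derivative
      (\<lambda>b. c * (b \<bullet> i) * (flat (m + 2) (c * (x \<bullet> i) + d) - real m * flat (m + 1) (c * (x \<bullet> i) + d))))
      (at x)" for x :: 'a
    by (rule has_derivative_eq_rhs,
        rule has_derivative_compose[OF _ flat_has_real_derivative[unfolded has_field_derivative_def]])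
       (auto intro!: derivative_eq_intros)
  have "flat_algebra (\<lambda>x. c * (b \<bullet> i) * (flat (m + 2) (c * (x \<bullet> i) + d)
          + (- real m) * flat (m + 1) (c * (x \<bullet> i) + d)))" for b :: 'a
    by (intro flat_algebra.intros)
  then show ?case
    using D by (auto simp: frechet_derivative_at[OF D, symmetric] differentiable_def)
next
  case (add f g)
  have D: "((\<lambda>x. f x + g x) has_derivative
      (\<lambda>b. frechet_derivative f (at x) b + frechet_derivative g (at x) b)) (at x)" for x
    using add.IH by (intro has_derivative_add) (auto simp: frechet_derivative_works[symmetric])
  then show ?case
    using add.IH by (auto simp: frechet_derivative_at[OF D, symmetric] differentiable_def intro: flat_algebra.add)
next
  case (mult f g)
  have D: "((\<lambda>x. f x * g x) has_derivative
      (\<lambda>b. f x * frechet_derivative g (at x) b + frechet_derivative f (at x) b * g x)) (at x)" for x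
    using mult.IH by (intro has_derivative_mult) (auto simp: frechet_derivative_works[symmetric])
  then show ?case
    using mult.IH mult.hyps
    by (auto simp: frechet_derivative_at[OF D, symmetric] differentiable_def
             intro!: flat_algebra.add flat_algebra.mult)
qed

text \<open>
  The order of differentiability is raised one step at a time: the directional derivatives are
  again members of the algebra, so the induction hypothesis applies to them.
\<close>
lemma flat_algebra_Ck: "flat_algebra f \<Longrightarrow> Ck_function k f"
proof (induction k arbitrary: f)
  case 0
  then show ?case
    using flat_algebra_derivative[of f]
    by (auto intro!: continuous_at_imp_continuous_on differentiable_imp_continuous_within)
next
  case (Suc k)
  then show ?case
    using flat_algebra_derivative[of f] by auto
qed

lemma flat_algebra_prod:
  "finite I \<Longrightarrow> (\<And>i. i \<in> I \<Longrightarrow> flat_algebra (f i)) \<Longrightarrow> flat_algebra (\<lambda>x. \<Prod>i\<in>I. f i x)"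
  by (induction rule: finite_induct) (auto intro: flat_algebra.intros)

text \<open>
  The parameter \<open>k\<close> stretches the cut-offs: as it grows, the bumps, all of which are supported in
  the same closed box, approximate the indicator of the open box.
\<close>
definition box_bump :: "'a::euclidean_space \<Rightarrow> 'a \<Rightarrow> real \<Rightarrow> 'a \<Rightarrow> real" where
  "box_bump a b k x = (\<Prod>i\<in>Basis. flat 0 (k * (x \<bullet> i - a \<bullet> i)) * flat 0 (k * (b \<bullet> i - x \<bullet> i)))"

lemma box_bump_bounds: "0 \<le> box_bump a b k x" "box_bump a b k x \<le> 1"
proof -
  have "0 \<le> flat 0 t" "flat 0 t \<le> 1" for t by (auto simp: flat_def)
  then show "0 \<le> box_bump a b k x" "box_bump a b k x \<le> 1"
    unfolding box_bump_def by (auto intro!: prod_nonneg prod_le_1 mult_le_one)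
qed

lemma box_bump_outside:
  assumes "x \<notin> box a b" "0 < k" shows "box_bump a b k x = 0"
proof -
  obtain i where "i \<in> Basis" "x \<bullet> i \<le> a \<bullet> i \<or> b \<bullet> i \<le> x \<bullet> i"
    using assms by (auto simp: mem_box not_less)
  then show ?thesis
    unfolding box_bump_def using assms(2)
    by (intro prod_zero) (auto simp: flat_def zero_less_mult_iff intro!: bexI[of _ i])
qed

text \<open>
  For positive \<open>t\<close> one has \<open>flat 0 (k t) = exp (- 1 / (k t))\<close>, which tends to one as \<open>k\<close> grows.
  The index is shifted because the stretching factor has to be positive.
\<close>
lemma box_bump_tendsto: "(\<lambda>n. box_bump a b (real (Suc n)) x) \<longlonglongrightarrow> indicator (box a b) x"
proof (cases "x \<in> box a b")
  case False
  then show ?thesis by (simp add: box_bump_outside del: of_nat_Suc)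
next
  case True
  have flat: "(\<lambda>n. flat 0 (real (Suc n) * t)) \<longlonglongrightarrow> 1" if "0 < t" for t
  proof -
    have "(\<lambda>n. exp (- (inverse (real (Suc n)) * (1 / t)))) \<longlonglongrightarrow> exp (- (0 * (1 / t)))"
      by (intro tendsto_intros LIMSEQ_inverse_real_of_nat)
    then show ?thesis
      using that by (simp add: flat_def field_simps del: of_nat_Suc)
  qed
  have "(\<lambda>n. box_bump a b (real (Suc n)) x) \<longlonglongrightarrow> (\<Prod>i\<in>(Basis::'a set). 1 * 1)"
    unfolding box_bump_def
    by (intro tendsto_prod tendsto_mult flat) (use True in \<open>auto simp: mem_box\<close>)
  then show ?thesis using True by simp
qed

lemma test_function_box_bump:
  assumes "cbox a b \<subseteq> S" "0 < k"
  shows "test_function S (box_bump a b k)"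
proof -
  have "flat_algebra (\<lambda>x. \<Prod>i\<in>Basis. flat 0 (k * (x \<bullet> i) + (- k * (a \<bullet> i)))
           * flat 0 ((- k) * (x \<bullet> i) + k * (b \<bullet> i)))"
    by (intro flat_algebra_prod flat_algebra.intros finite_Basis)
  also have "(\<lambda>x. \<Prod>i\<in>Basis. flat 0 (k * (x \<bullet> i) + (- k * (a \<bullet> i)))
           * flat 0 ((- k) * (x \<bullet> i) + k * (b \<bullet> i))) = box_bump a b k"
    by (simp add: fun_eq_iff box_bump_def algebra_simps)
  finally have "\<forall>n. Ck_function n (box_bump a b k)"
    by (auto intro: flat_algebra_Ck)
  moreover have "closure {x. box_bump a b k x \<noteq> 0} \<subseteq> cbox a b"
    using box_bump_outside[OF _ assms(2)] box_subset_cbox[of a b]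
    by (intro closure_minimal) auto
  ultimately show ?thesis
    using assms(1) unfolding test_function_def
    by (meson closed_closure compact_cbox compact_Int_closed compact_closure bounded_subset
          bounded_cbox closure_subset order_trans)
qed

section \<open>The fundamental lemma of the calculus of variations\<close>

text \<open>
  Local integrability only speaks of compact subsets, but countably many closed boxes exhaust an
  open set.
\<close>
lemma locally_integrable_measurable:
  fixes g :: "'a::euclidean_space \<Rightarrow> real"
  assumes "open S" "g locally_integrable_on S"
  shows "g \<in> borel_measurable (lebesgue_on S)"
proof -
  obtain \<D> where \<D>: "countable \<D>" "\<And>X. X \<in> \<D> \<Longrightarrow> X \<subseteq> S" "\<And>X. X \<in> \<D> \<Longrightarrow> \<exists>a b. X = cbox a b"
    "\<Union>\<D> = S"
    using open_countable_Union_open_cbox[OF assms(1)] by (metis PowD subsetD)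
  show ?thesis
  proof (rule measurable_piecewise_restrict[OF \<D>(1)])
    fix X assume X: "X \<in> \<D>"
    then obtain a b where ab: "X = cbox a b" using \<D>(3) by blast
    show "X \<inter> space (lebesgue_on S) \<in> sets (lebesgue_on S)"
      using \<open>open S\<close> \<D>(2)[OF X] by (auto simp: sets_restrict_space_iff ab)
    have "integrable (lebesgue_on X) g"
      using assms(2) \<D>(2)[OF X] unfolding locally_integrable_on_def ab by auto
    moreover have "restrict_space (lebesgue_on S) X = lebesgue_on X"
      using \<open>open S\<close> \<D>(2)[OF X]
      by (subst restrict_restrict_space) (auto simp: ab Int_absorb1)
    ultimately show "g \<in> borel_measurable (restrict_space (lebesgue_on S) X)"
      by (auto dest: borel_measurable_integrable)
  qed (use \<D>(4) in auto)
qed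

lemma locally_integrable_mult_continuous:
  fixes g \<psi> :: "'a::euclidean_space \<Rightarrow> real"
  assumes "g locally_integrable_on S" "continuous_on UNIV \<psi>" "compact K" "K \<subseteq> S"
    and "\<And>x. x \<notin> K \<Longrightarrow> \<psi> x = 0" and S: "S \<in> sets lebesgue"
  shows "integrable (lebesgue_on S) (\<lambda>x. g x * \<psi> x)"
proof -
  have "integrable (lebesgue_on K) g"
    using assms by (auto simp: locally_integrable_on_def)
  then have gK: "integrable lebesgue (\<lambda>x. indicator K x *\<^sub>R g x)"
    by (subst (asm) integrable_restrict_space) (auto simp: \<open>compact K\<close> borel_compact)
  have "compact (\<psi> ` K)"
    using assms by (meson compact_continuous_image continuous_on_subset subset_UNIV)
  then obtain B where B: "\<And>x. x \<in> K \<Longrightarrow> \<bar>\<psi> x\<bar> \<le> B"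
    by (metis bounded_real compact_imp_bounded imageI)
  have [measurable]: "\<psi> \<in> borel_measurable lebesgue"
    using assms(2) by (intro measurable_completion) (simp add: borel_measurable_continuous_onI)
  have "integrable lebesgue (\<lambda>x. (indicator K x *\<^sub>R g x) * \<psi> x)"
    using borel_measurable_integrable[OF gK]
    by (intro Bochner_Integration.integrable_bound[OF integrable_mult_left[OF gK, of B]])
       (auto intro!: AE_I2 mult_left_mono B[THEN order_trans] simp: abs_mult indicator_def)
  also have "(\<lambda>x. (indicator K x *\<^sub>R g x) * \<psi> x) = (\<lambda>x. indicator S x *\<^sub>R (g x * \<psi> x))"
    using assms(4,5) by (auto simp: fun_eq_iff indicator_def)
  finally show ?thesis
    by (subst integrable_restrict_space) (auto simp: S)
qed

text \<open>
  Dominated convergence along the bumps passes from test functions to the indicator of an open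
  box.
\<close>
lemma integral_box_eq_0:
  fixes g :: "'a::euclidean_space \<Rightarrow> real"
  assumes "open S" "g locally_integrable_on S"
    and test: "\<And>\<phi>. test_function S \<phi> \<Longrightarrow> (\<integral>x. g x * \<phi> x \<partial>lebesgue_on S) = 0"
    and "cbox a b \<subseteq> S"
  shows "(\<integral>x. indicator (box a b) x * g x \<partial>lebesgue) = 0"
proof -
  define G where "G x = indicator (cbox a b) x * g x" for x
  have "integrable (lebesgue_on (cbox a b)) g"
    using assms by (auto simp: locally_integrable_on_def)
  then have "integrable lebesgue (\<lambda>x. indicator (cbox a b) x * g x)"
    by (subst (asm) integrable_restrict_space) auto
  then have gI: "integrable lebesgue G"
    by (simp add: G_def[abs_def])
  note [measurable] = borel_measurable_integrable[OF gI]
  define \<phi> where "\<phi> n = box_bump a b (real (Suc n))" for n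
  have \<phi>: "test_function S (\<phi> n)" for n
    unfolding \<phi>_def by (rule test_function_box_bump[OF assms(4)]) simp
  have "continuous_on UNIV (\<phi> n)" for n
    using \<phi>[of n] by (metis test_function_def Ck_function.simps(1))
  then have [measurable]: "\<phi> n \<in> borel_measurable lebesgue" for n
    by (intro measurable_completion) (simp add: borel_measurable_continuous_onI)
  have 1: "(\<integral>x. G x * \<phi> n x \<partial>lebesgue) = 0" for n
  proof -
    have "0 = (\<integral>x. indicator S x *\<^sub>R (g x * \<phi> n x) \<partial>lebesgue)"
      using test[OF \<phi>[of n]] \<open>open S\<close> by (subst (asm) integral_restrict_space) auto
    also have "\<dots> = (\<integral>x. G x * \<phi> n x \<partial>lebesgue)"
      using assms(4) box_bump_outside[of _ a b "real (Suc n)"] box_subset_cbox[of a b]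
      unfolding \<phi>_def G_def
      by (intro Bochner_Integration.integral_cong) (auto simp: indicator_def)
    finally show ?thesis ..
  qed
  have "(\<lambda>n. \<integral>x. G x * \<phi> n x \<partial>lebesgue)
      \<longlonglongrightarrow> (\<integral>x. G x * indicator (box a b) x \<partial>lebesgue)"
  proof (rule integral_dominated_convergence)
    show "integrable lebesgue (\<lambda>x. norm (G x))"
      using gI by auto
    show "AE x in lebesgue. (\<lambda>n. G x * \<phi> n x)
            \<longlonglongrightarrow> G x * indicator (box a b) x"
      unfolding \<phi>_def by (intro AE_I2 tendsto_mult tendsto_const box_bump_tendsto)
    show "AE x in lebesgue. norm (G x * \<phi> n x)
            \<le> norm (G x)" for n
      unfolding norm_mult \<phi>_def
      using box_bump_bounds[of a b "real (Suc n)"] by (intro AE_I2 mult_right_le_one_le) auto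
  qed (auto intro!: borel_measurable_times borel_measurable_indicator)
  then have "(\<integral>x. G x * indicator (box a b) x \<partial>lebesgue) = 0"
    unfolding 1 by (simp add: LIMSEQ_const_iff)
  also have "(\<lambda>x. G x * indicator (box a b) x)
      = (\<lambda>x. indicator (box a b) x * g x)"
    using box_subset_cbox[of a b] by (auto simp: fun_eq_iff G_def indicator_def)
  finally show ?thesis .
qed

text \<open>
  The boxes form a \<open>\<pi>\<close>-system that generates the Borel sets, and the sets on which the integral
  vanishes form a Dynkin system, the vanishing of the total integral giving closure under
  complements.  A function whose integral vanishes on every Borel set is zero
  almost everywhere.
\<close>
lemma AE_eq_0_if_box_integrals_0:
  fixes h :: "'a::euclidean_space \<Rightarrow> real"
  assumes h: "integrable lborel h"
    and box: "\<And>a b. (\<integral>x. indicator (box a b) x * h x \<partial>lborel) = 0"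
    and UNIV: "(\<integral>x. h x \<partial>lborel) = 0"
  shows "AE x in lborel. h x = 0"
proof -
  have boxes: "sets (lborel :: 'a measure) = sigma_sets UNIV (range (\<lambda>(a, b). box a b))"
    by (simp add: borel_eq_box)
  show ?thesis
  proof (rule sigma_finite_measure.density_zero[OF sigma_finite_lborel h])
    fix A :: "'a set" assume "A \<in> sets lborel"
    then have A: "A \<in> sigma_sets UNIV (range (\<lambda>(a, b). box a b))"
      by (simp add: boxes[symmetric])
    have "Int_stable (range (\<lambda>(a, b). box a b :: 'a set))"
      by (auto simp: Int_stable_def box_Int_box)
    moreover have "range (\<lambda>(a, b). box a b :: 'a set) \<subseteq> Pow UNIV" by simp
    ultimately show "set_lebesgue_integral lborel A h = 0"
      using A
    proof (induction rule: sigma_sets_induct_disjoint)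
      case (basic A)
      then show ?case using box by (auto simp: set_lebesgue_integral_def)
    next
      case empty
      show ?case by (simp add: set_lebesgue_integral_def)
    next
      case (compl A)
      then have A: "A \<in> sets lborel"
        by (simp only: boxes)
      have "set_lebesgue_integral lborel (UNIV - A) h
          = (\<integral>x. h x - indicator A x *\<^sub>R h x \<partial>lborel)"
        unfolding set_lebesgue_integral_def
        by (intro Bochner_Integration.integral_cong) (auto simp: indicator_def)
      also have "\<dots> = (\<integral>x. h x \<partial>lborel) - set_lebesgue_integral lborel A h"
        unfolding set_lebesgue_integral_def
        by (intro Bochner_Integration.integral_diff h integrable_mult_indicator A)
      finally show ?case using compl UNIV by simp
    next
      case (union A)
      then have "A i \<in> sets lborel" for i
        unfolding boxes by auto
      moreover have "set_integrable lborel (\<Union>i. A i) h"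
        unfolding set_integrable_def using \<open>\<And>i. A i \<in> sets lborel\<close>
        by (intro integrable_mult_indicator h) auto
      ultimately have "set_lebesgue_integral lborel (\<Union>i. A i) h = (\<Sum>i. set_lebesgue_integral lborel (A i) h)"
        using union(1) by (intro lebesgue_integral_countable_add) (auto simp: disjoint_family_on_def)
      then show ?case using union by simp
    qed
  qed
qed

text \<open>
  The claim is local, so it suffices to treat \<open>g\<close> cut off to a box inside \<open>S\<close>.  The intersection of
  that box with any other one is a box inside \<open>S\<close> again, hence all box integrals of the cut-off
  function vanish.
\<close>
lemma fundamental_lemma_calculus_of_variations:
  fixes g :: "'a::euclidean_space \<Rightarrow> real"
  assumes "open S" "g locally_integrable_on S"
    and test: "\<And>\<phi>. test_function S \<phi> \<Longrightarrow> (\<integral>x. g x * \<phi> x \<partial>lebesgue_on S) = 0"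
  shows "AE x in lebesgue_on S. g x = 0"
proof -
  have local: "AE x in lebesgue. x \<in> cbox c d \<longrightarrow> g x = 0" if cd: "cbox c d \<subseteq> S" for c d
  proof -
    define f where "f x = indicator (box c d) x * g x" for x
    have "integrable (lebesgue_on (cbox c d)) g"
      using assms cd by (auto simp: locally_integrable_on_def)
    then have "integrable lebesgue (\<lambda>x. indicator (cbox c d) x *\<^sub>R g x)"
      by (subst (asm) integrable_restrict_space) auto
    then have "integrable lebesgue (\<lambda>x. indicator (box c d) x *\<^sub>R (indicator (cbox c d) x *\<^sub>R g x))"
      by (rule integrable_mult_indicator[rotated]) auto
    also have "(\<lambda>x. indicator (box c d) x *\<^sub>R (indicator (cbox c d) x *\<^sub>R g x)) = f"
      using box_subset_cbox[of c d] by (auto simp: f_def fun_eq_iff indicator_def)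
    finally have f: "integrable lebesgue f" .
    obtain h where [measurable]: "h \<in> borel_measurable lborel" and "AE x in lborel. f x = h x"
      using completion_ex_borel_measurable_real[OF borel_measurable_integrable[OF f]] by blast
    then have fh: "AE x in lebesgue. f x = h x"
      by (intro AE_completion)
    have h: "integrable lborel h"
    proof -
      have "integrable lebesgue h"
        using f fh by (subst integrable_cong_AE[where g = f]) (auto intro: measurable_completion)
      then show ?thesis by (subst (asm) integrable_completion) auto
    qed
    have [measurable]: "f \<in> borel_measurable lebesgue" "h \<in> borel_measurable lebesgue"
      using f by (auto intro: measurable_completion)
    have f0: "(\<integral>x. indicator (box a b) x * f x \<partial>lebesgue) = 0" for a b
    proof -
      obtain a' b' where ab: "box a b \<inter> box c d = box a' b'"
        by (rule that[OF box_Int_box])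
      have "(\<lambda>x. indicator (box a b) x * f x) = (\<lambda>x. indicator (box a' b') x * g x)"
        unfolding ab[symmetric] f_def by (auto simp: fun_eq_iff indicator_def)
      moreover have "(\<integral>x. indicator (box a' b') x * g x \<partial>lebesgue) = 0"
      proof (cases "box a' b' = {}")
        case False
        then have "cbox a' b' = closure (box a' b')" by simp
        also have "\<dots> \<subseteq> cbox c d"
          using ab box_subset_cbox[of c d] by (intro closure_minimal) auto
        finally show ?thesis
          using integral_box_eq_0[OF assms(1,2) test] cd by blast
      qed simp
      ultimately show ?thesis by simp
    qed
    have box: "(\<integral>x. indicator (box a b) x * h x \<partial>lborel) = 0" for a b
    proof -
      have "(\<integral>x. indicator (box a b) x * h x \<partial>lborel) = (\<integral>x. indicator (box a b) x * h x \<partial>lebesgue)"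
        by (subst integral_completion) auto
      also have "\<dots> = (\<integral>x. indicator (box a b) x * f x \<partial>lebesgue)"
        using fh by (intro integral_cong_AE borel_measurable_times borel_measurable_indicator) auto
      finally show ?thesis using f0 by simp
    qed
    have "(\<integral>x. h x \<partial>lborel) = (\<integral>x. h x \<partial>lebesgue)"
      by (subst integral_completion) auto
    also have "\<dots> = (\<integral>x. f x \<partial>lebesgue)"
      using fh by (intro integral_cong_AE) auto
    also have "f = (\<lambda>x. indicator (box c d) x * f x)"
      by (auto simp: fun_eq_iff f_def indicator_def)
    finally have UNIV: "(\<integral>x. h x \<partial>lborel) = 0"
      using f0 by simp
    have "AE x in lebesgue. h x = 0"
      by (intro AE_completion AE_eq_0_if_box_integrals_0 h box UNIV)
    \<comment> \<open>The test functions see the open box only, but it is the closed boxes that cover \<open>S\<close>.\<close>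
    moreover have "AE x in lebesgue. x \<notin> cbox c d - box c d"
      using negligible_frontier_interval[of c d]
      by (intro AE_not_in) (simp add: negligible_iff_null_sets)
    ultimately show ?thesis
      using fh by eventually_elim (auto simp: f_def)
  qed
  obtain \<D> where \<D>: "countable \<D>" "\<And>X. X \<in> \<D> \<Longrightarrow> X \<subseteq> S" "\<And>X. X \<in> \<D> \<Longrightarrow> \<exists>a b. X = cbox a b"
    "\<Union>\<D> = S"
    using open_countable_Union_open_cbox[OF assms(1)] by (metis PowD subsetD)
  have "AE x in lebesgue. \<forall>X\<in>\<D>. x \<in> X \<longrightarrow> g x = 0"
    unfolding AE_ball_countable[OF \<D>(1)] using \<D>(2,3) local by fast
  then show ?thesis
    using \<D>(4) \<open>open S\<close> by (subst AE_restrict_space_iff) (auto elim!: eventually_mono)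
qed

lemma test_function_compact_support:
  assumes "test_function S \<phi>"
  obtains K where "compact K" "K \<subseteq> S" "\<And>x. x \<notin> K \<Longrightarrow> \<phi> x = 0"
    "\<And>x b. x \<notin> K \<Longrightarrow> frechet_derivative \<phi> (at x) b = 0"
proof
  let ?K = "closure {x. \<phi> x \<noteq> 0}"
  show "compact ?K" "?K \<subseteq> S" using assms by (auto simp: test_function_def)
  show zero: "\<phi> x = 0" if "x \<notin> ?K" for x
    using that closure_subset[of "{x. \<phi> x \<noteq> 0}"] by auto
  show "frechet_derivative \<phi> (at x) b = 0" if x: "x \<notin> ?K" for x b
  proof -
    have "(\<phi> has_derivative (\<lambda>_. 0)) (at x)"
    proof (rule has_derivative_transform_within_open)
      show "((\<lambda>_. 0) has_derivative (\<lambda>_. 0)) (at x)" by simp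
      show "open (- ?K)" "x \<in> - ?K" using x by auto
      show "0 = \<phi> y" if "y \<in> - ?K" for y
        using zero[of y] that by simp
    qed
    from frechet_derivative_at[OF this] show ?thesis by metis
  qed
qed

lemma test_function_continuous:
  assumes "test_function S \<phi>"
  shows "continuous_on UNIV \<phi>" 
    "b \<in> Basis \<Longrightarrow> continuous_on UNIV (\<lambda>x. frechet_derivative \<phi> (at x) b)"
    "(\<phi> has_derivative frechet_derivative \<phi> (at x)) (at x)"
proof -
  have "Ck_function 0 \<phi>" "Ck_function (Suc 0) \<phi>"
    using assms unfolding test_function_def by blast+
  then show "continuous_on UNIV \<phi>" 
    "b \<in> Basis \<Longrightarrow> continuous_on UNIV (\<lambda>x. frechet_derivative \<phi> (at x) b)"
    "(\<phi> has_derivative frechet_derivative \<phi> (at x)) (at x)"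
    by (auto simp: frechet_derivative_works[symmetric])
qed

text \<open>
  The difference of two weak derivatives is orthogonal to all test functions.
\<close>
lemma weak_derivative_unique:
  assumes "open S" "has_weak_derivative S b u v" "has_weak_derivative S b u v'"
  shows "AE x in lebesgue_on S. v x = v' x"
proof -
  have v: "v locally_integrable_on S" "v' locally_integrable_on S"
    using assms by (auto simp: has_weak_derivative_def)
  have "AE x in lebesgue_on S. v x - v' x = 0"
  proof (rule fundamental_lemma_calculus_of_variations[OF assms(1)])
    show "(\<lambda>x. v x - v' x) locally_integrable_on S"
      using v by (auto simp: locally_integrable_on_def)
    fix \<phi> :: "'a \<Rightarrow> real" assume \<phi>: "test_function S \<phi>"
    obtain K where K: "compact K" "K \<subseteq> S" "\<And>x. x \<notin> K \<Longrightarrow> \<phi> x = 0"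
      using test_function_compact_support[OF \<phi>] by metis
    have "integrable (lebesgue_on S) (\<lambda>x. f x * \<phi> x)" if "f locally_integrable_on S" for f
      using \<open>open S\<close>
      by (intro locally_integrable_mult_continuous[OF that test_function_continuous(1)[OF \<phi>] K]) auto
    then have "(\<integral>x. (v x - v' x) * \<phi> x \<partial>lebesgue_on S)
        = (\<integral>x. v x * \<phi> x \<partial>lebesgue_on S) - (\<integral>x. v' x * \<phi> x \<partial>lebesgue_on S)"
      using v by (simp add: left_diff_distrib)
    then show "(\<integral>x. (v x - v' x) * \<phi> x \<partial>lebesgue_on S) = 0"
      using assms(2,3) \<phi> by (simp add: has_weak_derivative_def)
  qed
  then show ?thesis by simp
qed

section \<open>Integration over the subgraph\<close>

text \<open>
  Below a point \<open>(x, y)\<close> of the subgraph there is room for a real \<open>t\<close> with \<open>y < t < w x\<close>, and lower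
  semicontinuity keeps \<open>w\<close> above \<open>t\<close> near \<open>x\<close>.
\<close>
lemma open_subgraph:
  fixes w :: "'a::euclidean_space \<Rightarrow> ennreal"
  assumes "open S" "lower_semicontinuous_on S w"
  shows "open (subgraph S w)"
proof (rule open_prod_intro)
  fix z assume "z \<in> subgraph S w"
  then obtain x y where z: "z = (x, y)" "x \<in> S" "0 < y" "ennreal y < w x"
    by (auto simp: subgraph_def)
  then obtain t' where "ennreal y < t'" "t' < w x"
    using dense by blast
  moreover then obtain t where "0 \<le> t" "t' = ennreal t"
    by (cases t') auto
  ultimately have t: "y < t" "ennreal t < w x"
    using \<open>0 < y\<close> by (auto simp: ennreal_less_iff)
  have "\<forall>\<^sub>F x' in at x within S. ennreal t < w x'"
    using assms(2) z(2) t(2) unfolding lower_semicontinuous_on_def by blast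
  then have "\<forall>\<^sub>F x' in nhds x. ennreal t < w x'"
    using t(2) by (simp add: at_within_open[OF z(2) assms(1)] eventually_nhds_conv_at)
  then have "\<forall>\<^sub>F x' in nhds x. ennreal t < w x' \<and> x' \<in> S"
    by (intro eventually_conj eventually_nhds_in_open assms(1) z(2))
  then obtain U where U: "open U" "x \<in> U" "\<And>x'. x' \<in> U \<Longrightarrow> ennreal t < w x' \<and> x' \<in> S"
    by (auto simp: eventually_nhds)
  have "U \<times> {0<..<t} \<subseteq> subgraph S w"
  proof
    fix q assume "q \<in> U \<times> {0<..<t}"
    then obtain x' y' where q: "q = (x', y')" "x' \<in> U" "0 < y'" "y' < t" by auto
    then have "ennreal y' < ennreal t" by (intro ennreal_lessI) auto
    also have "\<dots> < w x'" using U(3) q by blast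
    finally show "q \<in> subgraph S w"
      using U(3) q by (simp add: subgraph_def)
  qed
  then show "\<exists>A B. open A \<and> open B \<and> z \<in> A \<times> B \<and> A \<times> B \<subseteq> subgraph S w"
    using U z t by (intro exI[of _ U] exI[of _ "{0<..<t}"]) auto
qed

lemma emeasure_below_ennreal: "emeasure lborel {y. 0 < y \<and> ennreal y < r} = r"
proof (cases r)
  case (real c)
  then have "{y. 0 < y \<and> ennreal y < r} = {0<..<c}"
    by (auto simp: ennreal_less_iff)
  then show ?thesis using real by simp
next
  case top
  have "of_nat n \<le> emeasure lborel {0::real<..}" for n
  proof -
    have "{0<..<real n} \<subseteq> {0<..}" by auto
    from emeasure_mono[OF this, of lborel] show ?thesis
      by (simp add: ennreal_of_nat_eq_real_of_nat)
  qed
  then have "emeasure lborel {0::real<..} = top"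
    by (metis ennreal_Ex_less_of_nat less_top not_less)
  moreover have "{y. 0 < y \<and> ennreal y < r} = {0<..}"
    using top by auto
  ultimately show ?thesis using top by simp
qed

lemma null_sets_fst_vimage:
  assumes "N \<in> null_sets (lborel :: 'a::euclidean_space measure)"
  shows "fst -` N \<in> null_sets (lborel :: ('a \<times> 'b::euclidean_space) measure)"
proof -
  have "emeasure (lborel \<Otimes>\<^sub>M lborel) (N \<times> (UNIV :: 'b set)) = emeasure lborel N * emeasure lborel (UNIV :: 'b set)"
    using assms by (intro lborel.emeasure_pair_measure_Times) auto
  moreover have "N \<times> (UNIV :: 'b set) \<in> sets borel"
    using assms by (intro borel_Times) auto
  moreover have "fst -` N = N \<times> (UNIV :: 'b set)" by auto
  ultimately show ?thesis
    using assms by (auto simp: lborel_prod null_sets_def)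
qed

lemma AE_lebesgue_fst:
  assumes "AE x in (lebesgue :: 'a::euclidean_space measure). P x"
  shows "AE z in (lebesgue :: ('a \<times> 'b::euclidean_space) measure). P (fst z)"
proof -
  have "AE x in lborel. P x" using assms by (simp add: AE_completion_iff)
  then obtain N where "N \<in> null_sets lborel" "{x. \<not> P x} \<subseteq> N"
    by (auto simp: eventually_ae_filter)
  then have "AE z in (lborel :: ('a \<times> 'b) measure). P (fst z)"
    by (intro AE_I'[OF null_sets_fst_vimage]) auto
  then show ?thesis by (rule AE_completion)
qed

text \<open>
  A continuous map need not be measurable between the completed measures; the projection is,
  because it pulls null sets back to null sets.
\<close>
lemma measurable_fst_lebesgue:
  "fst \<in> (lebesgue :: ('a::euclidean_space \<times> 'b::euclidean_space) measure) \<rightarrow>\<^sub>M lebesgue"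
proof (rule completion.measurable_completion2)
  have fst: "fst \<in> (lborel :: ('a \<times> 'b) measure) \<rightarrow>\<^sub>M lborel"
    by (simp add: borel_measurable_continuous_onI continuous_on_fst)
  then show fst': "fst \<in> (lebesgue :: ('a \<times> 'b) measure) \<rightarrow>\<^sub>M lborel"
    by (rule measurable_completion)
  show "null_sets (lborel :: 'a measure) \<subseteq> null_sets (distr (lebesgue :: ('a \<times> 'b) measure) lborel fst)"
  proof
    fix N :: "'a set" assume N: "N \<in> null_sets lborel"
    then have "fst -` N \<in> null_sets (lebesgue :: ('a \<times> 'b) measure)"
      by (intro null_sets_completionI null_sets_fst_vimage)
    then show "N \<in> null_sets (distr (lebesgue :: ('a \<times> 'b) measure) lborel fst)"
      using null_setsD2[OF N] fst' by (simp add: null_sets_distr_iff)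
  qed
qed

lemma measurable_fst_lebesgue_on:
  assumes "f \<in> borel_measurable (lebesgue_on S)" "W \<subseteq> S \<times> UNIV"
  shows "(\<lambda>z. f (fst z)) \<in> borel_measurable (lebesgue_on (W :: ('a::euclidean_space \<times> 'b::euclidean_space) set))"
proof -
  have "fst \<in> lebesgue_on W \<rightarrow>\<^sub>M lebesgue_on S"
    using assms(2) by (intro measurable_restrict_space3 measurable_fst_lebesgue) auto
  then show ?thesis
    using assms(1) by (rule measurable_compose)
qed

text \<open>
  Tonelli's theorem for the completed measure, reduced to the Borel case by replacing \<open>F\<close> with a
  Borel function that agrees with it almost everywhere.
\<close>
lemma nn_integral_fst_indicator:
  fixes F :: "'a::euclidean_space \<Rightarrow> ennreal" and W :: "('a \<times> 'b::euclidean_space) set"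
  assumes F: "F \<in> borel_measurable lebesgue" and W: "W \<in> sets borel"
  shows "(\<integral>\<^sup>+z. F (fst z) * indicator W z \<partial>lebesgue)
       = (\<integral>\<^sup>+x. F x * emeasure lborel {y. (x, y) \<in> W} \<partial>lebesgue)"
proof -
  obtain F0 where F0 [measurable]: "F0 \<in> borel_measurable lborel" and eq: "AE x in lborel. F x = F0 x"
    using completion_ex_borel_measurable[OF F] by blast
  have eq': "AE x in lebesgue. F x = F0 x" using eq by (rule AE_completion)
  have [measurable]: "W \<in> sets (lborel \<Otimes>\<^sub>M lborel)"
    unfolding lborel_prod using W by simp
  have "(\<integral>\<^sup>+z. F (fst z) * indicator W z \<partial>lebesgue) = (\<integral>\<^sup>+z. F0 (fst z) * indicator W z \<partial>lebesgue)"
    using AE_lebesgue_fst[OF eq'] by (intro nn_integral_cong_AE) auto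
  also have "\<dots> = (\<integral>\<^sup>+z. F0 (fst z) * indicator W z \<partial>(lborel \<Otimes>\<^sub>M lborel))"
    by (simp add: nn_integral_completion lborel_prod)
  also have "\<dots> = (\<integral>\<^sup>+x. \<integral>\<^sup>+y. F0 x * indicator W (x, y) \<partial>lborel \<partial>lborel)"
    by (subst lborel.nn_integral_fst[symmetric]) simp_all
  also have "\<dots> = (\<integral>\<^sup>+x. F0 x * emeasure lborel {y. (x, y) \<in> W} \<partial>lborel)"
  proof (rule nn_integral_cong)
    fix x :: 'a
    have slice: "{y. (x, y) \<in> W} \<in> sets lborel"
      using sets_Pair1[of W lborel lborel x] by (simp add: vimage_def)
    have "(\<integral>\<^sup>+y. F0 x * indicator W (x, y) \<partial>lborel) = (\<integral>\<^sup>+y. F0 x * indicator {y. (x, y) \<in> W} y \<partial>lborel)"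
      by (intro nn_integral_cong) (auto simp: indicator_def)
    also have "\<dots> = F0 x * emeasure lborel {y. (x, y) \<in> W}"
      using slice by (subst nn_integral_cmult_indicator) auto
    finally show "(\<integral>\<^sup>+y. F0 x * indicator W (x, y) \<partial>lborel) = F0 x * emeasure lborel {y. (x, y) \<in> W}" .
  qed
  also have "\<dots> = (\<integral>\<^sup>+x. F x * emeasure lborel {y. (x, y) \<in> W} \<partial>lebesgue)"
    unfolding nn_integral_completion using eq by (intro nn_integral_cong_AE) auto
  finally show ?thesis .
qed

text \<open>
  The slice of the subgraph over \<open>x\<close> is the interval from \<open>0\<close> to \<open>w x\<close>, so integrating a function of
  \<open>x\<close> alone over the subgraph produces the weight.  This identity is the source of every norm
  equality below; values \<open>w x = \<infinity>\<close> are covered as well.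
\<close>
lemma nn_integral_subgraph:
  fixes f :: "'a::euclidean_space \<Rightarrow> ennreal"
  assumes S: "open S" and W: "open (subgraph S w)" and f: "f \<in> borel_measurable (lebesgue_on S)"
  shows "(\<integral>\<^sup>+z. f (fst z) \<partial>lebesgue_on (subgraph S w)) = (\<integral>\<^sup>+x. f x * w x \<partial>lebesgue_on S)"
proof -
  have F: "(\<lambda>x. f x * indicator S x) \<in> borel_measurable lebesgue"
    using f S by (subst (asm) borel_measurable_restrict_space_iff_ennreal) auto
  have "(\<integral>\<^sup>+z. f (fst z) \<partial>lebesgue_on (subgraph S w))
      = (\<integral>\<^sup>+z. (f (fst z) * indicator S (fst z)) * indicator (subgraph S w) z \<partial>lebesgue)"
    using W by (subst nn_integral_restrict_space)
      (auto intro!: nn_integral_cong simp: indicator_def subgraph_def)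
  also have "\<dots> = (\<integral>\<^sup>+x. f x * indicator S x * emeasure lborel {y. (x, y) \<in> subgraph S w} \<partial>lebesgue)"
    using W by (intro nn_integral_fst_indicator F) auto
  also have "\<dots> = (\<integral>\<^sup>+x. f x * w x * indicator S x \<partial>lebesgue)"
    by (intro nn_integral_cong) (auto simp: indicator_def subgraph_def emeasure_below_ennreal)
  also have "\<dots> = (\<integral>\<^sup>+x. f x * w x \<partial>lebesgue_on S)"
    using S by (subst nn_integral_restrict_space) auto
  finally show ?thesis .
qed

text \<open>
  A compact \<open>K\<close> lies in the product of its two compact projections, so its slices have uniformly
  bounded measure.
\<close>
lemma locally_integrable_fst:
  fixes f :: "'a::euclidean_space \<Rightarrow> real" and W :: "('a \<times> 'b::euclidean_space) set"
  assumes f: "f locally_integrable_on S" and W: "W \<subseteq> S \<times> UNIV"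
  shows "(\<lambda>z. f (fst z)) locally_integrable_on W"
  unfolding locally_integrable_on_def
proof (intro allI impI, elim conjE)
  fix K assume K: "compact K" "K \<subseteq> W"
  define A where "A = fst ` K"
  define B where "B = snd ` K"
  have "compact A"
    unfolding A_def using K(1)
    by (intro compact_continuous_image continuous_on_fst continuous_on_id)
  moreover have "A \<subseteq> S"
    using K(2) W by (auto simp: A_def)
  ultimately have A: "compact A" "A \<subseteq> S" .
  have B: "compact B"
    unfolding B_def using K
    by (intro compact_continuous_image continuous_on_snd continuous_on_id)
  have KAB: "K \<subseteq> A \<times> B" by (force simp: A_def B_def)
  have fA: "integrable (lebesgue_on A) f"
    using f A by (auto simp: locally_integrable_on_def)
  have Aleb: "A \<in> sets lebesgue" and Kb: "K \<in> sets borel"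
    using A K by (auto simp: borel_compact)
  have F: "(\<lambda>x. ennreal \<bar>f x\<bar> * indicator A x) \<in> borel_measurable lebesgue"
    using fA Aleb by (subst borel_measurable_restrict_space_iff_ennreal[symmetric]) auto
  have "(\<integral>\<^sup>+z. ennreal (norm (f (fst z))) \<partial>lebesgue_on K)
      = (\<integral>\<^sup>+z. (ennreal \<bar>f (fst z)\<bar> * indicator A (fst z)) * indicator K z \<partial>lebesgue)"
    using Kb KAB by (subst nn_integral_restrict_space)
      (auto intro!: nn_integral_cong simp: indicator_def)
  also have "\<dots> = (\<integral>\<^sup>+x. ennreal \<bar>f x\<bar> * indicator A x * emeasure lborel {y. (x, y) \<in> K} \<partial>lebesgue)"
    by (intro nn_integral_fst_indicator F Kb)
  also have "\<dots> \<le> (\<integral>\<^sup>+x. ennreal \<bar>f x\<bar> * indicator A x * emeasure lborel B \<partial>lebesgue)"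
    using KAB B by (intro nn_integral_mono mult_left_mono emeasure_mono) (auto simp: borel_compact)
  also have "\<dots> = (\<integral>\<^sup>+x. ennreal \<bar>f x\<bar> * indicator A x \<partial>lebesgue) * emeasure lborel B"
    by (intro nn_integral_multc F)
  also have "\<dots> = (\<integral>\<^sup>+x. ennreal (norm (f x)) \<partial>lebesgue_on A) * emeasure lborel B"
    using Aleb by (subst nn_integral_restrict_space) auto
  also have "\<dots> < \<infinity>"
    using fA emeasure_compact_finite[OF B] by (auto simp: integrable_iff_bounded ennreal_mult_less_top)
  finally show "integrable (lebesgue_on K) (\<lambda>z. f (fst z))"
    using measurable_fst_lebesgue_on[OF borel_measurable_integrable[OF fA], of K] KAB
    by (auto simp: integrable_iff_bounded)
qed

text \<open>
  Fubini's theorem in the two orders of integration needed for weak derivatives: integrating over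
  the base first reduces derivatives in base directions to the base, and integrating over the
  fibre first disposes of derivatives in fibre directions.  The integrand is extended by zero
  outside \<open>W\<close>, which is harmless because \<open>\<psi>\<close> is supported in a compact subset of \<open>W\<close>.
\<close>
lemma integral_fst_times_continuous:
  fixes f :: "'a::euclidean_space \<Rightarrow> real" and \<psi> :: "'a \<times> 'b::euclidean_space \<Rightarrow> real"
  assumes S: "open S" and W: "open W" "W \<subseteq> S \<times> UNIV" and f: "f locally_integrable_on S"
    and \<psi>: "continuous_on UNIV \<psi>" and K: "compact K" "K \<subseteq> W" "\<And>z. z \<notin> K \<Longrightarrow> \<psi> z = 0"
  shows "(\<integral>z. f (fst z) * \<psi> z \<partial>lebesgue_on W)
       = (\<integral>y. \<integral>x. f x * \<psi> (x, y) \<partial>lebesgue_on S \<partial>lborel)" (is ?snd)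
    and "(\<And>x. (\<integral>y. \<psi> (x, y) \<partial>lborel) = 0) \<Longrightarrow> (\<integral>z. f (fst z) * \<psi> z \<partial>lebesgue_on W) = 0"
proof -
  have fm: "f \<in> borel_measurable (lebesgue_on S)"
    by (rule locally_integrable_measurable[OF S f])
  then have fS: "(\<lambda>x. indicator S x *\<^sub>R f x) \<in> borel_measurable lebesgue"
    using S by (subst (asm) borel_measurable_restrict_space_iff) auto
  obtain h where h [measurable]: "h \<in> borel_measurable lborel"
    and "AE x in lborel. indicator S x *\<^sub>R f x = h x"
    using completion_ex_borel_measurable_real[OF fS] by blast
  then have fh: "AE x in lebesgue. indicator S x * f x = h x"
    by (intro AE_completion) simp
  have \<psi>b [measurable]: "\<psi> \<in> borel_measurable borel"
    using \<psi> by (rule borel_measurable_continuous_onI)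
  have "(\<lambda>z. h (fst z) * \<psi> z) \<in> borel_measurable (lborel \<Otimes>\<^sub>M lborel)"
    using h \<psi>b by (intro borel_measurable_times measurable_compose[OF measurable_fst])
      (auto simp: lborel_prod)
  then have hb: "(\<lambda>z. h (fst z) * \<psi> z) \<in> borel_measurable lborel"
    by (simp add: lborel_prod)
  have "AE z in (lebesgue :: ('a \<times> 'b) measure). indicator W z *\<^sub>R (f (fst z) * \<psi> z) = h (fst z) * \<psi> z"
    using AE_lebesgue_fst[OF fh]
  proof eventually_elim
    case (elim z)
    show ?case
    proof (cases "z \<in> K")
      case True
      then have "z \<in> W" "fst z \<in> S" using K(2) W(2) by auto
      then show ?thesis using elim by simp
    next
      case False
      then show ?thesis using K(3) by simp
    qed
  qed
  note ae = this
  have int: "integrable (lebesgue_on W) (\<lambda>z. f (fst z) * \<psi> z)"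
    using W(1) by (intro locally_integrable_mult_continuous[OF locally_integrable_fst[OF f W(2)] \<psi> K]) auto
  then have int': "integrable lebesgue (\<lambda>z. indicator W z *\<^sub>R (f (fst z) * \<psi> z))"
    using W(1) by (subst (asm) integrable_restrict_space) auto
  have "integrable lebesgue (\<lambda>z. h (fst z) * \<psi> z)"
    using int' ae hb borel_measurable_integrable[OF int']
    by (subst integrable_cong_AE[where g = "\<lambda>z. indicator W z *\<^sub>R (f (fst z) * \<psi> z)"])
       (auto intro: measurable_completion)
  then have "integrable lborel (\<lambda>z. h (fst z) * \<psi> z)"
    using hb by (subst (asm) integrable_completion) auto
  then have hint: "integrable (lborel \<Otimes>\<^sub>M lborel) (\<lambda>z. h (fst z) * \<psi> z)"
    by (simp add: lborel_prod)
  have "(\<integral>z. f (fst z) * \<psi> z \<partial>lebesgue_on W) = (\<integral>z. indicator W z *\<^sub>R (f (fst z) * \<psi> z) \<partial>lebesgue)"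
    using W(1) by (subst integral_restrict_space) auto
  also have "\<dots> = (\<integral>z. h (fst z) * \<psi> z \<partial>lebesgue)"
    using ae hb borel_measurable_integrable[OF int']
    by (intro integral_cong_AE) (auto intro: measurable_completion)
  also have "\<dots> = (\<integral>z. h (fst z) * \<psi> z \<partial>(lborel \<Otimes>\<^sub>M lborel))"
    using hb by (subst integral_completion) (auto simp: lborel_prod)
  finally have eq: "(\<integral>z. f (fst z) * \<psi> z \<partial>lebesgue_on W) = (\<integral>z. h (fst z) * \<psi> z \<partial>(lborel \<Otimes>\<^sub>M lborel))" .
  \<comment> \<open>The almost everywhere equality of \<open>f\<close> and \<open>h\<close> on the base does not involve \<open>y\<close>, so this holds for every single \<open>y\<close>.\<close>
  have inner: "(\<integral>x. f x * \<psi> (x, y) \<partial>lebesgue_on S) = (\<integral>x. h x * \<psi> (x, y) \<partial>lborel)" for y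
  proof -
    have "continuous_on UNIV (\<lambda>x. \<psi> (x, y))"
      by (intro continuous_on_compose2[OF \<psi>] continuous_intros) auto
    then have sl: "(\<lambda>x. \<psi> (x, y)) \<in> borel_measurable lborel"
      by (simp add: borel_measurable_continuous_onI)
    have slh: "(\<lambda>x. h x * \<psi> (x, y)) \<in> borel_measurable lborel"
      using h sl by (intro borel_measurable_times)
    have "(\<integral>x. f x * \<psi> (x, y) \<partial>lebesgue_on S) = (\<integral>x. (indicator S x *\<^sub>R f x) * \<psi> (x, y) \<partial>lebesgue)"
      using S by (subst integral_restrict_space) (auto simp: mult.assoc)
    also have "\<dots> = (\<integral>x. h x * \<psi> (x, y) \<partial>lebesgue)"
      using fh measurable_completion[OF slh] borel_measurable_times[OF fS measurable_completion[OF sl]]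
      by (intro integral_cong_AE) auto
    also have "\<dots> = (\<integral>x. h x * \<psi> (x, y) \<partial>lborel)"
      using slh by (rule integral_completion)
    finally show ?thesis .
  qed
  show ?snd
    unfolding eq inner using hint lborel_pair.integral_snd[of "\<lambda>x y. h x * \<psi> (x, y)"]
    by (simp add: case_prod_unfold)
  show "(\<integral>z. f (fst z) * \<psi> z \<partial>lebesgue_on W) = 0" if "\<And>x. (\<integral>y. \<psi> (x, y) \<partial>lborel) = 0"
    unfolding eq using lborel_pair.integral_fst'[OF hint] that by simp
qed

section \<open>Weak derivatives of functions of the base variable\<close>

text \<open>
  The derivative of a slice is the slice of the derivative in a horizontal direction, and
  horizontal basis vectors \<open>(b, 0)\<close> belong to the basis of the product; so the order of
  differentiability passes to slices by induction.
\<close>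
lemma Ck_function_slice:
  fixes f :: "'a::euclidean_space \<times> 'b::euclidean_space \<Rightarrow> real"
  shows "Ck_function k f \<Longrightarrow> Ck_function k (\<lambda>x. f (x, y))"
    and "f differentiable (at (x, y)) \<Longrightarrow>
      frechet_derivative (\<lambda>x. f (x, y)) (at x) b = frechet_derivative f (at (x, y)) (b, 0)"
proof -
  have D: "((\<lambda>x. f (x, y)) has_derivative (\<lambda>b. frechet_derivative f (at (x, y)) (b, 0))) (at x)"
    if "f differentiable (at (x, y))" for f :: "'a \<times> 'b \<Rightarrow> real" and x
    using that unfolding frechet_derivative_works
    by (rule has_derivative_compose[rotated]) (auto intro!: derivative_eq_intros)
  show "f differentiable (at (x, y)) \<Longrightarrow>
      frechet_derivative (\<lambda>x. f (x, y)) (at x) b = frechet_derivative f (at (x, y)) (b, 0)"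
    using frechet_derivative_at[OF D] by metis
  show "Ck_function k f \<Longrightarrow> Ck_function k (\<lambda>x. f (x, y))"
  proof (induction k arbitrary: f)
    case 0
    then show ?case
      by (auto intro!: continuous_on_compose2[of UNIV f] continuous_intros)
  next
    case (Suc k)
    then have diff: "f differentiable (at z)" for z by (cases z) simp
    have "Ck_function k (\<lambda>x. frechet_derivative (\<lambda>x. f (x, y)) (at x) b)" if "b \<in> Basis" for b
    proof -
      have "Ck_function k (\<lambda>z. frechet_derivative f (at z) (b, 0))"
        using Suc.prems that by (auto simp: Basis_prod_def)
      then have "Ck_function k (\<lambda>x. frechet_derivative f (at (x, y)) (b, 0))"
        by (rule Suc.IH)
      then show ?thesis
        by (simp add: frechet_derivative_at[OF D[OF diff], symmetric])
    qed
    then show ?case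
      using D[OF diff] by (auto simp: differentiable_def)
  qed
qed

lemma test_function_slice:
  fixes \<phi> :: "'a::euclidean_space \<times> 'b::euclidean_space \<Rightarrow> real"
  assumes \<phi>: "test_function W \<phi>" and "W \<subseteq> S \<times> UNIV"
  shows "test_function S (\<lambda>x. \<phi> (x, y))"
proof -
  obtain K where K: "compact K" "K \<subseteq> W" "\<And>z. z \<notin> K \<Longrightarrow> \<phi> z = 0"
    using test_function_compact_support[OF \<phi>] by metis
  have cK: "compact (fst ` K)"
    using K(1) by (intro compact_continuous_image continuous_on_fst continuous_on_id)
  have "{x. \<phi> (x, y) \<noteq> 0} \<subseteq> fst ` K"
    using K(3) by force
  then have "closure {x. \<phi> (x, y) \<noteq> 0} \<subseteq> fst ` K"
    using cK by (intro closure_minimal compact_imp_closed)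
  moreover have "fst ` K \<subseteq> S" using K(2) assms(2) by auto
  ultimately show ?thesis
    using \<phi> cK Ck_function_slice(1)[of _ \<phi> y] unfolding test_function_def
    by (meson closed_closure compact_Int_closed compact_closure bounded_subset compact_imp_bounded
          closure_subset order_trans)
qed

text \<open>
  Every horizontal slice of a test function on \<open>W\<close> is a test function on \<open>S\<close>.  The defining
  identity of the weak derivative on \<open>S\<close>, applied to each slice and integrated over the height,
  is the one on \<open>W\<close>.
\<close>
lemma has_weak_derivative_fst:
  fixes u v :: "'a::euclidean_space \<Rightarrow> real" and W :: "('a \<times> 'b::euclidean_space) set"
  assumes S: "open S" and W: "open W" "W \<subseteq> S \<times> UNIV" and uv: "has_weak_derivative S b u v"
    and b: "b \<in> Basis"
  shows "has_weak_derivative W (b, 0) (\<lambda>z. u (fst z)) (\<lambda>z. v (fst z))"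
  unfolding has_weak_derivative_def
proof (intro conjI allI impI)
  have u: "u locally_integrable_on S" and v: "v locally_integrable_on S"
    using uv by (auto simp: has_weak_derivative_def)
  show "(\<lambda>z. u (fst z)) locally_integrable_on W" "(\<lambda>z. v (fst z)) locally_integrable_on W"
    using u v W by (auto intro: locally_integrable_fst)
  fix \<phi> :: "'a \<times> 'b \<Rightarrow> real" assume \<phi>: "test_function W \<phi>"
  obtain K where K: "compact K" "K \<subseteq> W" "\<And>z. z \<notin> K \<Longrightarrow> \<phi> z = 0"
    "\<And>z c. z \<notin> K \<Longrightarrow> frechet_derivative \<phi> (at z) c = 0"
    using test_function_compact_support[OF \<phi>] by metis
  have diff: "\<phi> differentiable (at z)" for z
    using test_function_continuous(3)[OF \<phi>, of z] unfolding differentiable_def by blast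
  have "(b, 0) \<in> (Basis :: ('a \<times> 'b) set)" using b by (auto simp: Basis_prod_def)
  note cont = test_function_continuous(2)[OF \<phi> this]
  have "(\<integral>z. u (fst z) * frechet_derivative \<phi> (at z) (b, 0) \<partial>lebesgue_on W)
      = (\<integral>y. \<integral>x. u x * frechet_derivative \<phi> (at (x, y)) (b, 0) \<partial>lebesgue_on S \<partial>lborel)"
    by (rule integral_fst_times_continuous(1)[OF S W u cont K(1,2,4)])
  also have "\<dots> = (\<integral>y. - (\<integral>x. v x * \<phi> (x, y) \<partial>lebesgue_on S) \<partial>lborel)"
    using uv test_function_slice[OF \<phi> W(2)] diff
    by (simp add: has_weak_derivative_def Ck_function_slice(2)[symmetric])
  also have "\<dots> = - (\<integral>z. v (fst z) * \<phi> z \<partial>lebesgue_on W)"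
    using integral_fst_times_continuous(1)[OF S W v test_function_continuous(1)[OF \<phi>] K(1-3)] by simp
  finally show "(\<integral>z. u (fst z) * frechet_derivative \<phi> (at z) (b, 0) \<partial>lebesgue_on W)
      = - (\<integral>z. v (fst z) * \<phi> z \<partial>lebesgue_on W)" .
qed

text \<open>
  A function of \<open>x\<close> alone comes out of the integral over \<open>y\<close>, and the integral of \<open>\<partial>\<phi> / \<partial>y\<close> along a
  vertical line is zero because \<open>\<phi>\<close> vanishes near both ends.
\<close>
lemma has_weak_derivative_fst_vertical:
  fixes u :: "'a::euclidean_space \<Rightarrow> real" and W :: "('a \<times> real) set"
  assumes S: "open S" and W: "open W" "W \<subseteq> S \<times> UNIV" and u: "u locally_integrable_on S"
  shows "has_weak_derivative W (0, 1) (\<lambda>z. u (fst z)) (\<lambda>_. 0)"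
  unfolding has_weak_derivative_def
proof (intro conjI allI impI)
  show "(\<lambda>z. u (fst z)) locally_integrable_on W" "(\<lambda>_. 0) locally_integrable_on W"
    using locally_integrable_fst[OF u W(2)] by (simp_all add: locally_integrable_on_def)
  fix \<phi> :: "'a \<times> real \<Rightarrow> real" assume \<phi>: "test_function W \<phi>"
  obtain K where K: "compact K" "K \<subseteq> W" "\<And>z. z \<notin> K \<Longrightarrow> \<phi> z = 0"
    "\<And>z c. z \<notin> K \<Longrightarrow> frechet_derivative \<phi> (at z) c = 0"
    using test_function_compact_support[OF \<phi>] by metis
  have "(0, 1) \<in> (Basis :: ('a \<times> real) set)" by (auto simp: Basis_prod_def)
  note cont = test_function_continuous(2)[OF \<phi> this]
  define D where "D z = frechet_derivative \<phi> (at z) (0, 1)" for z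
  have "bounded (snd ` K)"
    using K(1) by (intro compact_imp_bounded compact_continuous_image continuous_on_snd continuous_on_id)
  then obtain B where B: "0 < B" "\<And>z. z \<in> K \<Longrightarrow> \<bar>snd z\<bar> \<le> B"
    by (auto simp: bounded_pos)
  \<comment> \<open>The extra \<open>1\<close> puts the end points \<open>\<plusminus>R\<close> strictly outside the support.\<close>
  define R where "R = B + 1"
  have zero: "\<phi> (x, y) = 0" "D (x, y) = 0" if "\<bar>y\<bar> \<ge> R" for x y
    using K(3,4) B(2)[of "(x, y)"] that by (force simp: D_def R_def)+
  have "(\<integral>y. D (x, y) \<partial>lborel) = 0" for x
  proof -
    have "(\<integral>y. D (x, y) \<partial>lborel) = (\<integral>y. indicator {-R..R} y *\<^sub>R D (x, y) \<partial>lborel)"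
    proof (rule Bochner_Integration.integral_cong[OF refl])
      show "D (x, y) = indicator {-R..R} y *\<^sub>R D (x, y)" for y
        using zero(2)[of y x] by (cases "\<bar>y\<bar> \<ge> R") (auto simp: indicator_def)
    qed
    also have "\<dots> = \<phi> (x, R) - \<phi> (x, -R)"
    proof (rule integral_FTC_atLeastAtMost)
      show "- R \<le> R" using B(1) by (simp add: R_def)
      show "continuous_on {- R..R} (\<lambda>y. D (x, y))"
        unfolding D_def by (intro continuous_on_compose2[OF cont] continuous_intros) auto
      show "((\<lambda>y. \<phi> (x, y)) has_vector_derivative D (x, y)) (at y within {- R..R})" for y
      proof -
        have "((\<lambda>y. \<phi> (x, y)) has_derivative (\<lambda>h. frechet_derivative \<phi> (at (x, y)) (0, h))) (at y)"
          by (rule has_derivative_compose[OF _ test_function_continuous(3)[OF \<phi>]])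
             (auto intro!: derivative_eq_intros)
        moreover have "frechet_derivative \<phi> (at (x, y)) (0, h) = h *\<^sub>R D (x, y)" for h
        proof -
          have "linear (frechet_derivative \<phi> (at (x, y)))"
            using test_function_continuous(3)[OF \<phi>] by (rule has_derivative_linear)
          from linear_scale[OF this, of h "(0, 1)"] show ?thesis by (simp add: D_def)
        qed
        ultimately show ?thesis
          by (simp add: has_vector_derivative_def has_derivative_at_withinI)
      qed
    qed
    also have "\<dots> = 0" using zero(1)[of R x] zero(1)[of "-R" x] B(1) by (simp add: R_def)
    finally show ?thesis .
  qed
  then have "(\<integral>z. u (fst z) * D z \<partial>lebesgue_on W) = 0"
    unfolding D_def by (intro integral_fst_times_continuous(2)[OF S W u cont K(1,2,4)])
  then show "(\<integral>z. u (fst z) * frechet_derivative \<phi> (at z) (0, 1) \<partial>lebesgue_on W)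
      = - (\<integral>z. 0 * \<phi> z \<partial>lebesgue_on W)"
    by (simp add: D_def)
qed

section \<open>Convergence in unweighted spaces and the weak gradient\<close>

lemma Lp_space_unweighted_diff:
  assumes u: "u \<in> Lp_space p S unweighted" and v: "v \<in> Lp_space p S unweighted" and p: "1 \<le> p"
  shows "(\<lambda>x. u x - v x) \<in> Lp_space p S unweighted"
proof -
  have m [measurable]: "u \<in> borel_measurable (lebesgue_on S)" "v \<in> borel_measurable (lebesgue_on S)"
    and fin: "(\<integral>\<^sup>+x. ennreal (\<bar>u x\<bar> powr p) \<partial>lebesgue_on S) < \<infinity>"
      "(\<integral>\<^sup>+x. ennreal (\<bar>v x\<bar> powr p) \<partial>lebesgue_on S) < \<infinity>"
    using u v by (auto simp: Lp_space_def)
  have bound: "\<bar>a - b\<bar> powr p \<le> 2 powr p * (\<bar>a\<bar> powr p + \<bar>b\<bar> powr p)" for a b :: real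
  proof -
    \<comment> \<open>An elementary bound by the larger of the two terms replaces convexity of the power.\<close>
    have "\<bar>a - b\<bar> powr p \<le> (2 * max \<bar>a\<bar> \<bar>b\<bar>) powr p"
      using p by (intro powr_mono2) auto
    also have "\<dots> = 2 powr p * max \<bar>a\<bar> \<bar>b\<bar> powr p"
      by (simp add: powr_mult)
    also have "\<dots> \<le> 2 powr p * (\<bar>a\<bar> powr p + \<bar>b\<bar> powr p)"
      by (intro mult_left_mono) (auto simp: max_def)
    finally show ?thesis .
  qed
  have "(\<integral>\<^sup>+x. ennreal (\<bar>u x - v x\<bar> powr p) \<partial>lebesgue_on S)
      \<le> (\<integral>\<^sup>+x. ennreal (2 powr p) * (ennreal (\<bar>u x\<bar> powr p) + ennreal (\<bar>v x\<bar> powr p)) \<partial>lebesgue_on S)"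
    using bound by (intro nn_integral_mono) (simp add: ennreal_mult[symmetric] ennreal_plus[symmetric] ennreal_leI del: ennreal_plus)
  also have "\<dots> = ennreal (2 powr p) * ((\<integral>\<^sup>+x. ennreal (\<bar>u x\<bar> powr p) \<partial>lebesgue_on S)
        + (\<integral>\<^sup>+x. ennreal (\<bar>v x\<bar> powr p) \<partial>lebesgue_on S))"
    by (subst nn_integral_cmult, measurable) (subst nn_integral_add, measurable)
  also have "\<dots> < \<infinity>"
    using fin by (simp add: ennreal_mult_less_top)
  finally show ?thesis
    by (simp add: Lp_space_def)
qed

text \<open>
  The \<open>p\<close>-th powers of the differences converge to zero in \<open>L\<^sup>1\<close>, so the corresponding
  result for \<open>L\<^sup>1\<close> applies to them.
\<close>
lemma Lp_convergence_AE_subseq: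
  assumes f: "\<And>k. f k \<in> Lp_space p S unweighted" and v: "v \<in> Lp_space p S unweighted" and p: "1 \<le> p"
    and lim: "(\<lambda>k. Lp_norm p S unweighted (\<lambda>x. f k x - v x)) \<longlonglongrightarrow> 0"
  shows "\<exists>r::nat \<Rightarrow> nat. strict_mono r \<and> (AE x in lebesgue_on S. (\<lambda>k. f (r k) x) \<longlonglongrightarrow> v x)"
proof -
  define g where "g k x = \<bar>f k x - v x\<bar> powr p" for k x
  have d: "(\<lambda>x. f k x - v x) \<in> Lp_space p S unweighted" for k
    by (intro Lp_space_unweighted_diff f v p)
  then have [measurable]: "(\<lambda>x. f k x - v x) \<in> borel_measurable (lebesgue_on S)"
    and fin: "(\<integral>\<^sup>+x. ennreal (g k x) \<partial>lebesgue_on S) < \<infinity>" for k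
    by (auto simp: Lp_space_def g_def)
  have g: "g k \<in> borel_measurable (lebesgue_on S)" for k
    unfolding g_def by measurable
  have int: "integrable (lebesgue_on S) (g k)" for k
    using g fin by (intro integrableI_nonneg) (auto simp: g_def)
  have "(\<integral>x. norm (g k x) \<partial>lebesgue_on S) = Lp_norm p S unweighted (\<lambda>x. f k x - v x) powr p" for k
  proof -
    have "(\<integral>x. norm (g k x) \<partial>lebesgue_on S) = (\<integral>x. g k x \<partial>lebesgue_on S)"
      by (simp add: g_def)
    also have "\<dots> = enn2real (\<integral>\<^sup>+x. ennreal (g k x) \<partial>lebesgue_on S)"
      using g by (intro integral_eq_nn_integral) (auto simp: g_def)
    finally show ?thesis
      using p by (simp add: Lp_norm_def g_def powr_powr)
  qed
  moreover have "(\<lambda>k. Lp_norm p S unweighted (\<lambda>x. f k x - v x) powr p) \<longlonglongrightarrow> 0"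
    using tendsto_powr'[OF lim tendsto_const[of p]] p by (auto simp: Lp_norm_def)
  ultimately have "(\<lambda>k. \<integral>x. norm (g k x) \<partial>lebesgue_on S) \<longlonglongrightarrow> 0"
    by simp
  from tendsto_L1_AE_subseq[OF int this] obtain r :: "nat \<Rightarrow> nat"
    where r: "strict_mono r" "AE x in lebesgue_on S. (\<lambda>k. g (r k) x) \<longlonglongrightarrow> 0"
    by blast
  have "AE x in lebesgue_on S. (\<lambda>k. f (r k) x) \<longlonglongrightarrow> v x"
    using r(2)
  proof eventually_elim
    case (elim x)
    have "(\<lambda>k. g (r k) x powr (1 / p)) \<longlonglongrightarrow> 0 powr (1 / p)"
      using p by (intro tendsto_powr'[OF elim tendsto_const]) (auto simp: g_def)
    then have "(\<lambda>k. \<bar>f (r k) x - v x\<bar>) \<longlonglongrightarrow> 0"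
      using p by (simp add: g_def powr_powr)
    then have "(\<lambda>k. f (r k) x - v x) \<longlonglongrightarrow> 0"
      by (rule tendsto_rabs_zero_cancel)
    then show ?case
      by (rule LIM_zero_cancel)
  qed
  with r(1) show ?thesis by blast
qed

text \<open>
  The choice in the definition of the weak gradient is not vacuous: the weak partial derivatives
  assemble to a vector field.
\<close>
lemma weak_gradient_has_weak_derivative:
  assumes "u \<in> W1p_space p S w" "b \<in> Basis"
  shows "has_weak_derivative S b u (\<lambda>x. weak_gradient S u x \<bullet> b)"
proof -
  have "\<forall>b\<in>Basis. \<exists>v. has_weak_derivative S b u v"
    using assms(1) by (auto simp: W1p_space_def)
  then obtain v where v: "\<forall>b\<in>Basis. has_weak_derivative S b u (v b)"
    by metis
  have "\<forall>b\<in>Basis. has_weak_derivative S b u (\<lambda>x. (\<Sum>c\<in>Basis. v c x *\<^sub>R c) \<bullet> b)"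
    using v by (simp add: inner_sum_left inner_Basis if_distrib sum.delta cong: if_cong)
  then have "\<exists>g. \<forall>b\<in>Basis. has_weak_derivative S b u (\<lambda>x. g x \<bullet> b)"
    by (rule exI[of _ "\<lambda>x. \<Sum>c\<in>Basis. v c x *\<^sub>R c"])
  from someI_ex[OF this] show ?thesis
    using assms(2) unfolding weak_gradient_def by blast
qed

text \<open>
  The Sobolev norm is computed from one chosen representative of the gradient.  By this lemma any
  other representative may be used in its place.
\<close>
lemma weak_gradient_AE_eq:
  assumes "open S" "u \<in> W1p_space p S w"
    and g: "\<And>b. b \<in> Basis \<Longrightarrow> has_weak_derivative S b u (\<lambda>x. g x \<bullet> b)"
  shows "AE x in lebesgue_on S. weak_gradient S u x = g x"
proof -
  have "AE x in lebesgue_on S. weak_gradient S u x \<bullet> b = g x \<bullet> b" if "b \<in> Basis" for b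
    by (rule weak_derivative_unique[OF assms(1) weak_gradient_has_weak_derivative[OF assms(2) that] g[OF that]])
  then have "AE x in lebesgue_on S. \<forall>b\<in>Basis. weak_gradient S u x \<bullet> b = g x \<bullet> b"
    by (intro AE_finite_allI) auto
  then show ?thesis
    by eventually_elim (auto intro: euclidean_eqI)
qed

lemma weak_gradient_measurable:
  assumes "open S" "u \<in> W1p_space p S w"
  shows "weak_gradient S u \<in> borel_measurable (lebesgue_on S)"
proof (subst borel_measurable_euclidean_space, intro ballI)
  fix b :: 'a assume "b \<in> Basis"
  then show "(\<lambda>x. weak_gradient S u x \<bullet> b) \<in> borel_measurable (lebesgue_on S)"
    using weak_gradient_has_weak_derivative[OF assms(2)]
    by (intro locally_integrable_measurable[OF assms(1)]) (auto simp: has_weak_derivative_def)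
qed

section \<open>The isometric lifting to the subgraph\<close>

lemma subgraph_subset: "subgraph S w \<subseteq> S \<times> UNIV"
  by (auto simp: subgraph_def)

context
  fixes S :: "'a::euclidean_space set" and w :: "'a \<Rightarrow> ennreal" and p :: real
  assumes S: "open S" and W: "open (subgraph S w)"
begin

lemma nn_integral_powr_subgraph:
  assumes "u \<in> borel_measurable (lebesgue_on S)"
  shows "(\<integral>\<^sup>+z. ennreal (\<bar>u (fst z)\<bar> powr p) \<partial>lebesgue_on (subgraph S w))
       = (\<integral>\<^sup>+x. ennreal (\<bar>u x\<bar> powr p) * w x \<partial>lebesgue_on S)"
proof -
  note [measurable] = assms
  have "(\<lambda>x. ennreal (\<bar>u x\<bar> powr p)) \<in> borel_measurable (lebesgue_on S)"
    by measurable
  from nn_integral_subgraph[OF S W this] show ?thesis .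
qed

lemma Lp_norm_subgraph:
  assumes "u \<in> borel_measurable (lebesgue_on S)"
  shows "Lp_norm p (subgraph S w) unweighted (\<lambda>z. u (fst z)) = Lp_norm p S w u"
  using nn_integral_powr_subgraph[OF assms] by (simp add: Lp_norm_def)

lemma Lp_space_subgraph:
  assumes "u \<in> Lp_space p S w"
  shows "(\<lambda>z. u (fst z)) \<in> Lp_space p (subgraph S w) unweighted"
proof -
  have "u \<in> borel_measurable (lebesgue_on S)" using assms by (simp add: Lp_space_def)
  then show ?thesis
    using assms nn_integral_powr_subgraph[of u] measurable_fst_lebesgue_on[OF _ subgraph_subset, of u]
    by (simp add: Lp_space_def)
qed

lemma W1p_space_subgraph:
  assumes u: "u \<in> W1p_space p S w"
  shows "(\<lambda>z. u (fst z)) \<in> W1p_space p (subgraph S w) unweighted"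
  unfolding W1p_space_def mem_Collect_eq
proof (intro conjI ballI)
  show "(\<lambda>z. u (fst z)) \<in> Lp_space p (subgraph S w) unweighted"
    using u by (intro Lp_space_subgraph) (auto simp: W1p_space_def)
  fix B :: "'a \<times> real" assume "B \<in> Basis"
  then consider b where "b \<in> Basis" "B = (b, 0)" | "B = (0, 1)"
    by (auto simp: Basis_prod_def)
  then show "\<exists>v\<in>Lp_space p (subgraph S w) unweighted. has_weak_derivative (subgraph S w) B (\<lambda>z. u (fst z)) v"
  proof cases
    case 1
    then obtain v where v: "v \<in> Lp_space p S w" "has_weak_derivative S b u v"
      using u by (auto simp: W1p_space_def)
    then show ?thesis
      using has_weak_derivative_fst[OF S W subgraph_subset v(2)] 1 Lp_space_subgraph by blast
  next
    case 2
    obtain b :: 'a where "b \<in> Basis" using nonempty_Basis by blast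
    then have "u locally_integrable_on S"
      using u by (auto simp: W1p_space_def has_weak_derivative_def)
    then have "has_weak_derivative (subgraph S w) B (\<lambda>z. u (fst z)) (\<lambda>_. 0)"
      unfolding 2 by (rule has_weak_derivative_fst_vertical[OF S W subgraph_subset])
    then show ?thesis
      by (intro bexI[of _ "\<lambda>_. 0"]) (auto simp: Lp_space_def)
  qed
qed

text \<open>
  The weak gradient of the lifted function is \<open>(\<nabla>u, 0)\<close>, whose norm is that of \<open>\<nabla>u\<close>.
\<close>
lemma W1p_norm_subgraph:
  assumes u: "u \<in> W1p_space p S w"
  shows "W1p_norm p (subgraph S w) unweighted (\<lambda>z. u (fst z)) = W1p_norm p S w u"
proof -
  let ?g = "weak_gradient S u"
  have um: "u \<in> borel_measurable (lebesgue_on S)"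
    using u by (auto simp: W1p_space_def Lp_space_def)
  have "has_weak_derivative (subgraph S w) B (\<lambda>z. u (fst z)) (\<lambda>z. (?g (fst z), 0) \<bullet> B)"
    if "B \<in> Basis" for B :: "'a \<times> real"
  proof -
    consider b where "b \<in> Basis" "B = (b, 0)" | "B = (0, 1)"
      using \<open>B \<in> Basis\<close> by (auto simp: Basis_prod_def)
    then show ?thesis
    proof cases
      case 1
      then show ?thesis
        using has_weak_derivative_fst[OF S W subgraph_subset weak_gradient_has_weak_derivative[OF u 1(1)] 1(1)]
        by simp
    next
      case 2
      obtain b :: 'a where "b \<in> Basis" using nonempty_Basis by blast
      then have "u locally_integrable_on S"
        using u by (auto simp: W1p_space_def has_weak_derivative_def)
      then show ?thesis
        unfolding 2 using has_weak_derivative_fst_vertical[OF S W subgraph_subset] by simp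
    qed
  qed
  from weak_gradient_AE_eq[OF W W1p_space_subgraph[OF u] this]
  have ae: "AE z in lebesgue_on (subgraph S w). weak_gradient (subgraph S w) (\<lambda>z. u (fst z)) z = (?g (fst z), 0)" .
  have "(\<integral>\<^sup>+z. ennreal (norm (weak_gradient (subgraph S w) (\<lambda>z. u (fst z)) z) powr p) \<partial>lebesgue_on (subgraph S w))
      = (\<integral>\<^sup>+z. ennreal (\<bar>norm (?g (fst z))\<bar> powr p) \<partial>lebesgue_on (subgraph S w))"
    using ae by (intro nn_integral_cong_AE) (auto simp: norm_Pair)
  also have "\<dots> = (\<integral>\<^sup>+x. ennreal (\<bar>norm (?g x)\<bar> powr p) * w x \<partial>lebesgue_on S)"
    by (rule nn_integral_powr_subgraph[OF measurable_compose[OF weak_gradient_measurable[OF S u] borel_measurable_norm]])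
  finally show ?thesis
    using nn_integral_powr_subgraph[OF um] by (simp add: W1p_norm_def)
qed

text \<open>
  The limit \<open>v\<close> on the subgraph depends on \<open>x\<close> only, up to a null set, since along a subsequence it
  is a pointwise limit of functions of \<open>x\<close>.  Taking the same pointwise limit on the base gives \<open>u\<close>.
\<close>
lemma Lp_limit_on_subgraph:
  assumes p: "1 \<le> p" and f: "\<And>k. f k \<in> Lp_space p S w" and v: "v \<in> Lp_space p (subgraph S w) unweighted"
    and lim: "(\<lambda>k. Lp_norm p (subgraph S w) unweighted (\<lambda>z. f k (fst z) - v z)) \<longlonglongrightarrow> 0"
  shows "\<exists>u\<in>Lp_space p S w. (\<lambda>k. Lp_norm p S w (\<lambda>x. f k x - u x)) \<longlonglongrightarrow> 0"
proof -
  let ?W = "subgraph S w"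
  obtain r :: "nat \<Rightarrow> nat"
    where r: "AE z in lebesgue_on ?W. (\<lambda>k. f (r k) (fst z)) \<longlonglongrightarrow> v z"
    using Lp_convergence_AE_subseq[OF Lp_space_subgraph[OF f] v p lim] by blast
  \<comment> \<open>Where the sequence diverges, \<open>lim\<close> has an unspecified value; \<open>u\<close> is measurable all the same.\<close>
  define u where "u x = lim (\<lambda>k. f (r k) x)" for x
  have fm: "f k \<in> borel_measurable (lebesgue_on S)" for k
    using f[of k] by (simp add: Lp_space_def)
  have um: "u \<in> borel_measurable (lebesgue_on S)"
    unfolding u_def[abs_def] by (intro borel_measurable_lim_metric fm)
  have uv: "AE z in lebesgue_on ?W. v z = u (fst z)"
    using r unfolding u_def by eventually_elim (simp add: limI)
  have "(\<integral>\<^sup>+x. ennreal (\<bar>u x\<bar> powr p) * w x \<partial>lebesgue_on S) = (\<integral>\<^sup>+z. ennreal (\<bar>v z\<bar> powr p) \<partial>lebesgue_on ?W)"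
    unfolding nn_integral_powr_subgraph[OF um, symmetric]
    using uv by (intro nn_integral_cong_AE) auto
  then have "u \<in> Lp_space p S w"
    using um v by (simp add: Lp_space_def)
  moreover have "Lp_norm p S w (\<lambda>x. f k x - u x) = Lp_norm p ?W unweighted (\<lambda>z. f k (fst z) - v z)" for k
  proof -
    have "Lp_norm p S w (\<lambda>x. f k x - u x) = Lp_norm p ?W unweighted (\<lambda>z. f k (fst z) - u (fst z))"
      by (rule Lp_norm_subgraph[symmetric]) (intro borel_measurable_diff fm um)
    also have "(\<integral>\<^sup>+z. ennreal (\<bar>f k (fst z) - u (fst z)\<bar> powr p) \<partial>lebesgue_on ?W)
        = (\<integral>\<^sup>+z. ennreal (\<bar>f k (fst z) - v z\<bar> powr p) \<partial>lebesgue_on ?W)"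
      using uv by (intro nn_integral_cong_AE) auto
    then have "Lp_norm p ?W unweighted (\<lambda>z. f k (fst z) - u (fst z))
        = Lp_norm p ?W unweighted (\<lambda>z. f k (fst z) - v z)"
      by (simp add: Lp_norm_def)
    finally show ?thesis .
  qed
  ultimately show ?thesis
    using lim by (intro bexI[of _ u]) simp_all
qed

end

theorem theorem4p3:
  fixes \<Omega> :: "(real ^ 'n) set" and w :: "real ^ 'n \<Rightarrow> ennreal" and p :: real
  assumes "open \<Omega>"
    and "1 \<le> p"
    and "admissible_weight p \<Omega> w"
    and "W1p_compactly_embedded p (subgraph \<Omega> w) unweighted"
  shows "W1p_compactly_embedded p \<Omega> w"
proof -
  let ?W = "subgraph \<Omega> w"
  have W: "open ?W"
    using assms(1,3) by (intro open_subgraph) (auto simp: admissible_weight_def)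
  note lift = W1p_space_subgraph[OF assms(1) W] W1p_norm_subgraph[OF assms(1) W]
  have emb: "\<exists>C. \<forall>u\<in>W1p_space p ?W unweighted. Lp_norm p ?W unweighted u \<le> C * W1p_norm p ?W unweighted u"
    and cpt: "\<And>s :: nat \<Rightarrow> _ \<Rightarrow> real.
        (\<And>k. s k \<in> W1p_space p ?W unweighted) \<Longrightarrow> (\<exists>M. \<forall>k. W1p_norm p ?W unweighted (s k) \<le> M) \<Longrightarrow>
        \<exists>v\<in>Lp_space p ?W unweighted. \<exists>r :: nat \<Rightarrow> nat. strict_mono r \<and>
           (\<lambda>k. Lp_norm p ?W unweighted (\<lambda>x. s (r k) x - v x)) \<longlonglongrightarrow> 0"
    using assms(4) unfolding W1p_compactly_embedded_def compact_embedding_def by blast+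
  have Lp: "u \<in> Lp_space p \<Omega> w" if "u \<in> W1p_space p \<Omega> w" for u
    using that by (simp add: W1p_space_def)
  show ?thesis
    unfolding W1p_compactly_embedded_def compact_embedding_def
  proof (intro conjI allI impI subsetI)
    show "u \<in> Lp_space p \<Omega> w" if "u \<in> W1p_space p \<Omega> w" for u
      using that by (rule Lp)
  next
    obtain C where C: "\<And>u. u \<in> W1p_space p ?W unweighted \<Longrightarrow>
        Lp_norm p ?W unweighted u \<le> C * W1p_norm p ?W unweighted u"
      using emb by blast
    have "Lp_norm p \<Omega> w u \<le> C * W1p_norm p \<Omega> w u" if u: "u \<in> W1p_space p \<Omega> w" for u
    proof -
      have "u \<in> borel_measurable (lebesgue_on \<Omega>)"
        using Lp[OF u] by (simp add: Lp_space_def)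
      from Lp_norm_subgraph[OF assms(1) W this, of p] show ?thesis
        using C[OF lift(1)[OF u]] lift(2)[OF u] by simp
    qed
    then show "\<exists>C. \<forall>u\<in>W1p_space p \<Omega> w. Lp_norm p \<Omega> w u \<le> C * W1p_norm p \<Omega> w u"
      by blast
  next
    fix s :: "nat \<Rightarrow> real ^ 'n \<Rightarrow> real"
    assume s: "(\<forall>k. s k \<in> W1p_space p \<Omega> w) \<and> (\<exists>M. \<forall>k. W1p_norm p \<Omega> w (s k) \<le> M)"
    have "\<exists>v\<in>Lp_space p ?W unweighted. \<exists>r :: nat \<Rightarrow> nat. strict_mono r \<and>
           (\<lambda>k. Lp_norm p ?W unweighted (\<lambda>z. s (r k) (fst z) - v z)) \<longlonglongrightarrow> 0"
      using s lift by (intro cpt) auto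
    then obtain v r where v: "v \<in> Lp_space p ?W unweighted" and r: "strict_mono (r :: nat \<Rightarrow> nat)"
      and lim: "(\<lambda>k. Lp_norm p ?W unweighted (\<lambda>z. s (r k) (fst z) - v z)) \<longlonglongrightarrow> 0"
      by blast
    have "\<exists>u\<in>Lp_space p \<Omega> w. (\<lambda>k. Lp_norm p \<Omega> w (\<lambda>x. s (r k) x - u x)) \<longlonglongrightarrow> 0"
      using s by (intro Lp_limit_on_subgraph[OF assms(1) W assms(2) _ v lim] Lp) auto
    then show "\<exists>u\<in>Lp_space p \<Omega> w. \<exists>r :: nat \<Rightarrow> nat. strict_mono r \<and>
           (\<lambda>k. Lp_norm p \<Omega> w (\<lambda>x. s (r k) x - u x)) \<longlonglongrightarrow> 0"
      using r by blast
  qed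
qed

end
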